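(* Let $1<p<3$, $q>1$, and let $F\in C^1(\mathbb{R})$ satisfy $F(0)=F'(0)=0$ and, for some constants $c>0$ and $\delta\in(0,1)$, $$F(u)\ge c\left(\ln\frac{1}{|u|}\right)^{1-p}|u|\ \text{ for } 0<|u|\le\delta,\qquad F(u)\ge c|u|^q\ \text{ for } |u|\ge\delta .$$ Let $u_0=0$ and let $u_1\in C_c(\mathbb{H}^2)$ be a spherically symmetric (i.e. depending only on $|x|$, $u_1=u_1(|x|)$), nonnegative, continuous, compactly supported function such that, for some constant $\tau_0>0$, $u_1(\tau)\ge1$ for all $\tau\in[\tau_0,3\tau_0]$. Then for every $\varepsilon>0$ the weak solution of $$\partial_t^2u-\left(\Delta_{\mathbb{H}^2}+\tfrac14\right)u=F(u),\qquad u(0,x)=0,\quad u_t(0,x)=\varepsilon u_1(x)$$ blows up in finite time, i.e. it does not extend to a weak solution in $C([0,\infty)\times\mathbb{H}^2)$.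
   Context: $\mathbb{H}^2$ is the two-dimensional hyperbolic space (curvature $-1$) with a fixed origin $O$; in geodesic polar coordinates $(r,\omega)\in(0,\infty)\times\mathbb{S}^1$ around $O$ the metric is $dr^2+(\sinh r)^2d\omega^2$. $d(x,y)$ is the geodesic distance, $|x|=d(O,x)$, and $\Delta_{\mathbb{H}^2}$ is the Laplace–Beltrami operator. All functions are real-valued. For $s>0$, $M^sf(x)=\frac{1}{|S_s(x)|}\int_{S_s(x)}f\,d\sigma$ is the mean of $f$ over the geodesic circle $S_s(x)=\{y: d(x,y)=s\}$. For $t>0$, $$I(t,x,f)=\int_0^t\frac{\sinh s}{\sqrt{2\cosh t-2\cosh s}}\,M^sf(x)\,ds,$$ with $I(0,x,f)=0$; this is the solution of the linear equation $\partial_t^2w-(\Delta_{\mathbb{H}^2}+\frac14)w=0$ with data $w(0,\cdot)=0$, $w_t(0,\cdot)=f$. A weak solution on a time interval $J\ni 0$, $J\subset[0,\infty)$, is a function $u\in C(J\times\mathbb{H}^2)$ satisfying $$u(t,x)=\varepsilon I(t,x,u_1)+\int_0^tI(t-\tau,x,F(u(\tau,\cdot)))\,d\tau,\quad t\in J.$$ *)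

theory Defs
  imports "HOL-Complex_Analysis.Complex_Analysis"
begin

section \<open>The hyperbolic plane (Poincare disc model)\<close>

text \<open>The unit disc with the metric \<open>4 |dz|\<^sup>2 / (1 - |z|\<^sup>2)\<^sup>2\<close>, which has curvature \<open>-1\<close>;
  the origin \<open>O\<close> is the point \<open>0\<close>. The hyperbolic topology is the Euclidean one, so continuity
  and compactness of subsets are the library's. The Euclidean distance of type \<^typ>\<open>complex\<close> is
  used for nothing else.\<close>

definition hyp_plane :: "complex set" where
  "hyp_plane = ball 0 1"

definition hyp_speed :: "(real \<Rightarrow> complex) \<Rightarrow> real \<Rightarrow> real" where
  "hyp_speed \<gamma> t = 2 / (1 - (norm (\<gamma> t))\<^sup>2) * norm (vector_derivative \<gamma> (at t))"

definition hyp_arc_integral :: "(real \<Rightarrow> complex) \<Rightarrow> real \<Rightarrow> real \<Rightarrow> (complex \<Rightarrow> real) \<Rightarrow> real" where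
  "hyp_arc_integral \<gamma> a b f = integral {a..b} (\<lambda>t. f (\<gamma> t) * hyp_speed \<gamma> t)"

abbreviation hyp_length :: "(real \<Rightarrow> complex) \<Rightarrow> real \<Rightarrow> real \<Rightarrow> real" where
  "hyp_length \<gamma> a b \<equiv> hyp_arc_integral \<gamma> a b (\<lambda>_. 1)"

text \<open>We do not use \<^const>\<open>valid_path\<close> here: it allows the derivative to be unbounded near
  the exceptional points, in which case the length integral may not exist (and would then be \<open>0\<close>).\<close>

definition hyp_curves :: "complex \<Rightarrow> complex \<Rightarrow> (real \<Rightarrow> complex) set" where
  "hyp_curves x y = {\<gamma>. \<gamma> C1_differentiable_on {0..1} \<and> path_image \<gamma> \<subseteq> hyp_plane
                        \<and> pathstart \<gamma> = x \<and> pathfinish \<gamma> = y}"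

definition hyp_dist :: "complex \<Rightarrow> complex \<Rightarrow> real" where
  "hyp_dist x y = (INF \<gamma>\<in>hyp_curves x y. hyp_length \<gamma> 0 1)"

definition hyp_circle :: "complex \<Rightarrow> real \<Rightarrow> complex set" where
  "hyp_circle x s = {y \<in> hyp_plane. hyp_dist x y = s}"

text \<open>Geodesic polar coordinates \<open>(r, \<theta>)\<close> around \<open>x\<close>: the usual ones around \<open>0\<close>, transported by
  the isometry \<open>z \<mapsto> (z + x) / (1 + cnj x * z)\<close> of the disc. For fixed \<open>r = s > 0\<close> this
  traverses the geodesic circle \<open>S\<^sub>s(x)\<close> once, see \<open>bij_betw_hyp_polar\<close> below.\<close>

definition hyp_polar :: "complex \<Rightarrow> real \<Rightarrow> real \<Rightarrow> complex" where
  "hyp_polar x r \<theta> = Moebius_function 0 (-x) (of_real (tanh (r / 2)) * cis \<theta>)"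

definition hyp_mean :: "real \<Rightarrow> (complex \<Rightarrow> real) \<Rightarrow> complex \<Rightarrow> real" where
  "hyp_mean s f x = hyp_arc_integral (hyp_polar x s) 0 (2 * pi) f / hyp_length (hyp_polar x s) 0 (2 * pi)"


section \<open>The wave equation\<close>

definition wave_I :: "real \<Rightarrow> complex \<Rightarrow> (complex \<Rightarrow> real) \<Rightarrow> real" where
  "wave_I t x f = integral {0..t} (\<lambda>s. sinh s / sqrt (2 * cosh t - 2 * cosh s) * hyp_mean s f x)"

definition weak_solution ::
  "(real \<Rightarrow> real) \<Rightarrow> real \<Rightarrow> (complex \<Rightarrow> real) \<Rightarrow> real set \<Rightarrow> (real \<Rightarrow> complex \<Rightarrow> real) \<Rightarrow> bool" where
  "weak_solution F \<epsilon> u1 J u \<longleftrightarrow>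
     is_interval J \<and> 0 \<in> J \<and> J \<subseteq> {0..} \<and>
     continuous_on (J \<times> hyp_plane) (\<lambda>(t, x). u t x) \<and>
     (\<forall>t\<in>J. \<forall>x\<in>hyp_plane.
        u t x = \<epsilon> * wave_I t x u1 + integral {0..t} (\<lambda>\<tau>. wave_I (t - \<tau>) x (\<lambda>y. F (u \<tau> y))))"


section \<open>Consistency of the model\<close>

lemma Moebius_inverse:
  assumes "x \<in> hyp_plane" "z \<in> hyp_plane"
  shows "Moebius_function 0 x (Moebius_function 0 (-x) z) = z"
    and "Moebius_function 0 (-x) (Moebius_function 0 x z) = z"
  using assms Moebius_function_compose[of "-x" x z] Moebius_function_compose[of x "-x" z]
  by (auto simp: hyp_plane_def)

lemma Moebius_in_hyp_plane:
  assumes "x \<in> hyp_plane" "z \<in> hyp_plane"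
  shows "Moebius_function 0 x z \<in> hyp_plane"
  using assms Moebius_function_norm_lt_1 by (auto simp: hyp_plane_def)

lemma hyp_plane_denom:
  assumes "x \<in> hyp_plane" "z \<in> hyp_plane"
  shows "1 - cnj x * z \<noteq> 0"
proof -
  have "norm (cnj x * z) < 1 * 1"
    using assms unfolding norm_mult hyp_plane_def by (intro mult_strict_mono') auto
  then show ?thesis by auto
qed

lemma Moebius_has_field_derivative:
  assumes "x \<in> hyp_plane" "z \<in> hyp_plane"
  shows "(Moebius_function 0 x has_field_derivative (1 - cnj x * x) / (1 - cnj x * z)\<^sup>2) (at z)"
proof -
  have "1 - cnj x * z \<noteq> 0" using hyp_plane_denom assms by blast
  then have "((\<lambda>z. (z - x) / (1 - cnj x * z)) has_field_derivative (1 - cnj x * x) / (1 - cnj x * z)\<^sup>2) (at z)"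
    by (auto intro!: derivative_eq_intros simp: divide_simps power2_eq_square) (simp add: algebra_simps)
  then show ?thesis by (simp add: Moebius_function_def)
qed

lemma Moebius_one_minus_norm:
  assumes "x \<in> hyp_plane" "z \<in> hyp_plane"
  shows "1 - (norm (Moebius_function 0 x z))\<^sup>2 = (1 - (norm x)\<^sup>2) * (1 - (norm z)\<^sup>2) / (norm (1 - cnj x * z))\<^sup>2"
proof -
  have "(norm (1 - cnj x * z))\<^sup>2 \<noteq> 0" using hyp_plane_denom assms by auto
  moreover have "(norm (1 - cnj x * z))\<^sup>2 - (norm (z - x))\<^sup>2 = (1 - (norm x)\<^sup>2) * (1 - (norm z)\<^sup>2)"
    unfolding cmod_power2 by (simp add: algebra_simps power2_eq_square)
  ultimately show ?thesis
    by (simp add: Moebius_function_def norm_divide power_divide diff_divide_eq_iff flip: diff_divide_distrib)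
qed

lemma Moebius_isometry_aux:
  assumes "x \<in> hyp_plane" "z \<in> hyp_plane"
  shows "2 / (1 - (norm (Moebius_function 0 x z))\<^sup>2) * norm ((1 - cnj x * x) / (1 - cnj x * z)\<^sup>2)
         = 2 / (1 - (norm z)\<^sup>2)"
proof -
  have "norm x < 1" "norm z < 1" using assms by (auto simp: hyp_plane_def)
  then have *: "(norm x)\<^sup>2 < 1" "(norm z)\<^sup>2 < 1" by (auto simp: abs_square_less_1)
  have "cnj x * x = of_real ((norm x)\<^sup>2)"
    by (metis complex_norm_square mult.commute of_real_power)
  then have "norm (1 - cnj x * x) = 1 - (norm x)\<^sup>2"
    using * by (metis norm_of_real of_real_1 of_real_diff abs_of_pos diff_gt_0_iff_gt)
  moreover have "norm (1 - cnj x * z) \<noteq> 0" using hyp_plane_denom assms by auto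
  ultimately show ?thesis
    using * unfolding Moebius_one_minus_norm[OF assms] by (simp add: norm_divide norm_power)
qed

lemma hyp_speed_Moebius:
  assumes "x \<in> hyp_plane" "\<gamma> t \<in> hyp_plane" "\<gamma> differentiable (at t)"
  shows "hyp_speed (Moebius_function 0 x \<circ> \<gamma>) t = hyp_speed \<gamma> t"
proof -
  let ?D = "(1 - cnj x * x) / (1 - cnj x * \<gamma> t)\<^sup>2"
  have "(\<gamma> has_vector_derivative vector_derivative \<gamma> (at t)) (at t)"
    using assms(3) vector_derivative_works by blast
  then have "(Moebius_function 0 x \<circ> \<gamma> has_vector_derivative vector_derivative \<gamma> (at t) * ?D) (at t)"
    using field_vector_diff_chain_at Moebius_has_field_derivative[OF assms(1,2)] by blast
  then have "vector_derivative (Moebius_function 0 x \<circ> \<gamma>) (at t) = vector_derivative \<gamma> (at t) * ?D"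
    by (rule vector_derivative_at)
  then have "hyp_speed (Moebius_function 0 x \<circ> \<gamma>) t
    = (2 / (1 - (norm (Moebius_function 0 x (\<gamma> t)))\<^sup>2) * norm ?D) * norm (vector_derivative \<gamma> (at t))"
    by (simp only: hyp_speed_def norm_mult comp_apply mult_ac)
  then show ?thesis
    unfolding Moebius_isometry_aux[OF assms(1,2)] hyp_speed_def .
qed

lemma Moebius_hyp_curves:
  assumes x: "x \<in> hyp_plane" and \<gamma>: "\<gamma> \<in> hyp_curves y z"
  shows "Moebius_function 0 x \<circ> \<gamma> \<in> hyp_curves (Moebius_function 0 x y) (Moebius_function 0 x z)"
    and "hyp_length (Moebius_function 0 x \<circ> \<gamma>) 0 1 = hyp_length \<gamma> 0 1"
proof -
  have C1: "\<gamma> C1_differentiable_on {0..1}" and im: "\<And>t. t \<in> {0..1} \<Longrightarrow> \<gamma> t \<in> hyp_plane"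
    using \<gamma> by (auto simp: hyp_curves_def path_image_def)
  have cont: "continuous_on {0..1} (\<lambda>t. vector_derivative \<gamma> (at t))"
    and diff: "\<And>t. t \<in> {0..1} \<Longrightarrow> \<gamma> differentiable (at t)"
    using C1 by (auto simp: C1_differentiable_on_eq)
  have cont\<gamma>: "continuous_on {0..1} \<gamma>"
    by (intro continuous_at_imp_continuous_on ballI differentiable_imp_continuous_within diff)
  let ?D = "\<lambda>t. vector_derivative \<gamma> (at t) * ((1 - cnj x * x) / (1 - cnj x * \<gamma> t)\<^sup>2)"
  have "(Moebius_function 0 x \<circ> \<gamma> has_vector_derivative ?D t) (at t)" if "t \<in> {0..1}" for t
    using diff[OF that]
    by (intro field_vector_diff_chain_at Moebius_has_field_derivative x im that)
       (simp add: vector_derivative_works)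
  moreover have "continuous_on {0..1} ?D"
    using hyp_plane_denom[OF x im] by (intro continuous_intros cont cont\<gamma>) auto
  ultimately have "(Moebius_function 0 x \<circ> \<gamma>) C1_differentiable_on {0..1}"
    unfolding C1_differentiable_on_def by (intro exI[of _ ?D]) auto
  then show "Moebius_function 0 x \<circ> \<gamma> \<in> hyp_curves (Moebius_function 0 x y) (Moebius_function 0 x z)"
    using \<gamma> Moebius_in_hyp_plane[OF x im]
    by (auto simp: hyp_curves_def path_image_def pathstart_def pathfinish_def)
  show "hyp_length (Moebius_function 0 x \<circ> \<gamma>) 0 1 = hyp_length \<gamma> 0 1"
    unfolding hyp_arc_integral_def
    by (intro integral_cong) (simp add: hyp_speed_Moebius x im diff)
qed

lemma hyp_length_lower_bound:
  assumes \<gamma>: "\<gamma> \<in> hyp_curves 0 w"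
  shows "2 * artanh (norm w) \<le> hyp_length \<gamma> 0 1"
proof -
  have C1: "\<gamma> C1_differentiable_on {0..1}" and im: "\<And>t. t \<in> {0..1} \<Longrightarrow> norm (\<gamma> t) < 1"
    and ends: "\<gamma> 0 = 0" "\<gamma> 1 = w"
    using \<gamma> by (auto simp: hyp_curves_def path_image_def pathstart_def pathfinish_def hyp_plane_def image_subset_iff)
  have cont: "continuous_on {0..1} (\<lambda>t. vector_derivative \<gamma> (at t))"
    and diff: "\<And>t. t \<in> {0..1} \<Longrightarrow> \<gamma> differentiable (at t)"
    using C1 by (auto simp: C1_differentiable_on_eq)
  have cont\<gamma>: "continuous_on {0..1} \<gamma>"
    by (intro continuous_at_imp_continuous_on ballI differentiable_imp_continuous_within diff)
  define a where "a t = sgn w \<bullet> \<gamma> t" for t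
  define a' where "a' t = sgn w \<bullet> vector_derivative \<gamma> (at t)" for t
  have sgn_le: "\<bar>sgn w \<bullet> v\<bar> \<le> norm v" for v
    using Cauchy_Schwarz_ineq2[of "sgn w" v] by (cases "w = 0") (auto simp: norm_sgn)
  have a_le: "\<bar>a t\<bar> \<le> norm (\<gamma> t)" "\<bar>a' t\<bar> \<le> norm (vector_derivative \<gamma> (at t))" for t
    using sgn_le by (auto simp: a_def a'_def)
  have a_deriv: "(a has_vector_derivative a' t) (at t within {0..1})" if "t \<in> {0..1}" for t
  proof -
    have "(\<gamma> has_vector_derivative vector_derivative \<gamma> (at t)) (at t within {0..1})"
      using diff[OF that] vector_derivative_works has_vector_derivative_at_within by blast
    then show ?thesis
      unfolding a_def a'_def
      by (rule bounded_linear.has_vector_derivative[OF bounded_linear_inner_right])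
  qed
  have "((\<lambda>t. 2 * (a' t / (1 - (a t)\<^sup>2))) has_integral 2 * artanh (a 1) - 2 * artanh (a 0)) {0..1}"
  proof (rule fundamental_theorem_of_calculus)
    fix t :: real assume t: "t \<in> {0..1}"
    have "\<bar>a t\<bar> < 1" using a_le(1)[of t] im[OF t] by linarith
    have "(a has_field_derivative a' t) (at t within {0..1})"
      using a_deriv[OF t] by (simp add: has_real_derivative_iff_has_vector_derivative)
    then have "(artanh \<circ> a has_field_derivative 1 / (1 - (a t)\<^sup>2) * a' t) (at t within {0..1})"
      using artanh_real_has_field_derivative[OF \<open>\<bar>a t\<bar> < 1\<close>] by (intro DERIV_image_chain) auto
    then have "((\<lambda>t. 2 * artanh (a t)) has_field_derivative 2 * (a' t / (1 - (a t)\<^sup>2))) (at t within {0..1})"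
      by (auto intro!: derivative_eq_intros simp: o_def)
    then show "((\<lambda>t. 2 * artanh (a t)) has_vector_derivative 2 * (a' t / (1 - (a t)\<^sup>2))) (at t within {0..1})"
      by (simp add: has_real_derivative_iff_has_vector_derivative)
  qed simp
  moreover have "a 0 = 0" "a 1 = norm w"
    by (cases "w = 0"; simp add: a_def ends sgn_div_norm dot_square_norm power2_eq_square)+
  ultimately have 1: "((\<lambda>t. 2 * (a' t / (1 - (a t)\<^sup>2))) has_integral 2 * artanh (norm w)) {0..1}"
    by simp
  have nz: "1 - (norm (\<gamma> t))\<^sup>2 > 0" if "t \<in> {0..1}" for t
    using im[OF that] by (simp add: abs_square_less_1)
  have "continuous_on {0..1} (\<lambda>t. hyp_speed \<gamma> t)"
    unfolding hyp_speed_def using nz by (intro continuous_intros cont cont\<gamma>) fastforce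
  then have 2: "((\<lambda>t. hyp_speed \<gamma> t) has_integral hyp_length \<gamma> 0 1) {0..1}"
    unfolding hyp_arc_integral_def
    by (simp add: integrable_integral integrable_continuous_interval)
  show ?thesis
  proof (rule has_integral_le[OF 1 2])
    fix t :: real assume t: "t \<in> {0..1}"
    have "(a t)\<^sup>2 \<le> (norm (\<gamma> t))\<^sup>2"
      using power_mono[OF a_le(1)[of t], of 2] by simp
    then have "a' t / (1 - (a t)\<^sup>2) \<le> norm (vector_derivative \<gamma> (at t)) / (1 - (norm (\<gamma> t))\<^sup>2)"
      using a_le(2)[of t] nz[OF t] by (intro frac_le) auto
    then show "2 * (a' t / (1 - (a t)\<^sup>2)) \<le> hyp_speed \<gamma> t"
      by (simp add: hyp_speed_def)
  qed
qed

lemma hyp_length_segment: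
  assumes "w \<in> hyp_plane"
  shows "(\<lambda>t. of_real t * w) \<in> hyp_curves 0 w"
    and "hyp_length (\<lambda>t. of_real t * w) 0 1 = 2 * artanh (norm w)"
proof -
  have w: "norm w < 1" using assms by (simp add: hyp_plane_def)
  have im: "\<bar>t\<bar> * norm w < 1" if "t \<in> {0..1}" for t :: real
    using that w by (smt (verit) atLeastAtMost_iff mult_left_le_one_le norm_ge_zero)
  have D: "((\<lambda>t. of_real t * w) has_vector_derivative w) (at t)" for t
    by (auto intro!: derivative_eq_intros has_vector_derivative_real_field)
  then have "(\<lambda>t. of_real t * w) C1_differentiable_on {0..1}"
    unfolding C1_differentiable_on_def by (intro exI[of _ "\<lambda>_. w"]) auto
  then show "(\<lambda>t. of_real t * w) \<in> hyp_curves 0 w"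
    using im by (auto simp: hyp_curves_def path_image_def hyp_plane_def pathstart_def pathfinish_def norm_mult)
  have "((\<lambda>t. 2 * (norm w / (1 - (t * norm w)\<^sup>2))) has_integral
          2 * artanh (1 * norm w) - 2 * artanh (0 * norm w)) {0..1}"
  proof (rule fundamental_theorem_of_calculus)
    fix t :: real assume t: "t \<in> {0..1}"
    then have "\<bar>t * norm w\<bar> < 1" using im[OF t] by (simp add: abs_mult)
    then have "(artanh \<circ> (\<lambda>t. t * norm w) has_field_derivative 1 / (1 - (t * norm w)\<^sup>2) * norm w) (at t within {0..1})"
      by (intro DERIV_image_chain artanh_real_has_field_derivative) (auto intro!: derivative_eq_intros)
    then have "((\<lambda>t. 2 * artanh (t * norm w)) has_field_derivative 2 * (norm w / (1 - (t * norm w)\<^sup>2))) (at t within {0..1})"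
      by (auto intro!: derivative_eq_intros simp: o_def)
    then show "((\<lambda>t. 2 * artanh (t * norm w)) has_vector_derivative 2 * (norm w / (1 - (t * norm w)\<^sup>2))) (at t within {0..1})"
      by (simp add: has_real_derivative_iff_has_vector_derivative)
  qed simp
  moreover have "hyp_speed (\<lambda>t. of_real t * w) t = 2 * (norm w / (1 - (t * norm w)\<^sup>2))" for t
    using vector_derivative_at[OF D] by (simp add: hyp_speed_def norm_mult power_mult_distrib)
  ultimately show "hyp_length (\<lambda>t. of_real t * w) 0 1 = 2 * artanh (norm w)"
    unfolding hyp_arc_integral_def by (simp add: integral_unique)
qed

lemma hyp_dist_eq:
  assumes x: "x \<in> hyp_plane" and y: "y \<in> hyp_plane"
  shows "hyp_dist x y = 2 * artanh (norm (Moebius_function 0 x y))"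
  unfolding hyp_dist_def
proof (rule cInf_eq_minimum)
  let ?w = "Moebius_function 0 x y"
  let ?\<gamma> = "Moebius_function 0 (-x) \<circ> (\<lambda>t. of_real t * ?w)"
  have w: "?w \<in> hyp_plane" and x': "-x \<in> hyp_plane"
    using Moebius_in_hyp_plane x y by (auto simp: hyp_plane_def)
  have "Moebius_function 0 (-x) 0 = x" by (simp add: Moebius_function_def)
  then have "?\<gamma> \<in> hyp_curves x y"
    using Moebius_hyp_curves(1)[OF x' hyp_length_segment(1)[OF w]] Moebius_inverse(2)[OF x y] by simp
  moreover have "hyp_length ?\<gamma> 0 1 = 2 * artanh (norm ?w)"
    using Moebius_hyp_curves(2)[OF x' hyp_length_segment(1)[OF w]] hyp_length_segment(2)[OF w] by simp
  ultimately show "2 * artanh (norm ?w) \<in> (\<lambda>\<gamma>. hyp_length \<gamma> 0 1) ` hyp_curves x y"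
    by (intro image_eqI) auto
  fix l assume "l \<in> (\<lambda>\<gamma>. hyp_length \<gamma> 0 1) ` hyp_curves x y"
  then obtain \<gamma> where \<gamma>: "\<gamma> \<in> hyp_curves x y" "l = hyp_length \<gamma> 0 1" by blast
  have "Moebius_function 0 x \<circ> \<gamma> \<in> hyp_curves 0 ?w"
    using Moebius_hyp_curves(1)[OF x \<gamma>(1)] by (simp add: Moebius_function_eq_zero)
  then show "2 * artanh (norm ?w) \<le> l"
    using hyp_length_lower_bound Moebius_hyp_curves(2)[OF x \<gamma>(1)] \<gamma>(2) by fastforce
qed

lemma tanh_cis_in_hyp_plane: "of_real (tanh r) * cis \<theta> \<in> hyp_plane"
  using tanh_real_bounds[of r] by (auto simp: hyp_plane_def norm_mult abs_less_iff)

lemma hyp_polar_in_hyp_plane: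
  assumes "x \<in> hyp_plane"
  shows "hyp_polar x r \<theta> \<in> hyp_plane"
  using assms Moebius_in_hyp_plane[OF _ tanh_cis_in_hyp_plane, of "-x" "r/2" \<theta>]
  by (simp add: hyp_polar_def hyp_plane_def)

lemma hyp_dist_hyp_polar:
  assumes "x \<in> hyp_plane" "0 \<le> r"
  shows "hyp_dist x (hyp_polar x r \<theta>) = r"
proof -
  have "hyp_dist x (hyp_polar x r \<theta>) = 2 * artanh (norm (of_real (tanh (r / 2)) * cis \<theta>))"
    using hyp_dist_eq[OF assms(1) hyp_polar_in_hyp_plane[OF assms(1)]] Moebius_inverse(1)[OF assms(1) tanh_cis_in_hyp_plane]
    by (simp add: hyp_polar_def)
  also have "\<dots> = r" using assms(2) by (simp add: norm_mult artanh_tanh_real)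
  finally show ?thesis .
qed

lemma bij_betw_hyp_polar:
  assumes x: "x \<in> hyp_plane" and s: "0 < s"
  shows "bij_betw (hyp_polar x s) {0..<2 * pi} (hyp_circle x s)"
proof -
  have T: "tanh (s / 2) > 0" using s by simp
  have "inj_on (hyp_polar x s) {0..<2 * pi}"
  proof (rule inj_onI)
    fix \<theta> \<eta> assume *: "\<theta> \<in> {0..<2 * pi}" "\<eta> \<in> {0..<2 * pi}" "hyp_polar x s \<theta> = hyp_polar x s \<eta>"
    then have "of_real (tanh (s / 2)) * cis \<theta> = of_real (tanh (s / 2)) * cis \<eta>"
      using Moebius_inverse(1)[OF x tanh_cis_in_hyp_plane] unfolding hyp_polar_def by metis
    moreover have "Arg2pi (of_real (tanh (s / 2)) * cis \<theta>) = \<theta>" if "\<theta> \<in> {0..<2 * pi}" for \<theta>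
      using that T by (intro Arg2pi_unique[of "tanh (s / 2)"]) (auto simp: cis_conv_exp)
    ultimately show "\<theta> = \<eta>" using * by metis
  qed
  moreover have "hyp_polar x s ` {0..<2 * pi} = hyp_circle x s"
  proof
    show "hyp_polar x s ` {0..<2 * pi} \<subseteq> hyp_circle x s"
      using hyp_polar_in_hyp_plane[OF x] hyp_dist_hyp_polar[OF x] s by (auto simp: hyp_circle_def)
    show "hyp_circle x s \<subseteq> hyp_polar x s ` {0..<2 * pi}"
    proof
      fix y assume y: "y \<in> hyp_circle x s"
      let ?w = "Moebius_function 0 x y"
      have yD: "y \<in> hyp_plane" using y by (simp add: hyp_circle_def)
      then have w: "norm ?w < 1" using Moebius_in_hyp_plane[OF x] by (simp add: hyp_plane_def)
      have "tanh (artanh (norm ?w)) = norm ?w"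
      proof -
        have pos: "1 + norm ?w > 0" "1 - norm ?w > 0" using w by (smt (verit) norm_ge_zero)+
        have E: "exp (- 2 * artanh (norm ?w)) = (1 - norm ?w) / (1 + norm ?w)"
          using pos by (simp add: artanh_def exp_minus)
        then show ?thesis
          using pos unfolding tanh_real_altdef E by (simp add: divide_simps)
      qed
      moreover have "artanh (norm ?w) = s / 2"
        using y hyp_dist_eq[OF x yD] by (simp add: hyp_circle_def)
      ultimately have "norm ?w = tanh (s / 2)" by simp
      then have "?w = of_real (tanh (s / 2)) * cis (Arg2pi ?w)"
        using Arg2pi_eq[of ?w] by (simp add: cis_conv_exp mult.commute)
      then have "y = hyp_polar x s (Arg2pi ?w)"
        using Moebius_inverse(2)[OF x yD] unfolding hyp_polar_def by simp
      then show "y \<in> hyp_polar x s ` {0..<2 * pi}"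
        using Arg2pi[of ?w] by auto
    qed
  qed
  ultimately show ?thesis by (simp add: bij_betw_def)
qed

lemma hyp_speed_hyp_polar:
  assumes x: "x \<in> hyp_plane" and s: "0 \<le> s"
  shows "hyp_speed (hyp_polar x s) \<theta> = sinh s"
proof -
  let ?T = "tanh (s / 2)"
  have D: "((\<lambda>\<theta>. of_real ?T * cis \<theta>) has_vector_derivative of_real ?T * (\<i> * cis \<theta>)) (at \<theta>)"
    by (auto intro!: derivative_eq_intros simp: has_vector_derivative_def scaleR_conv_of_real)
  have "-x \<in> hyp_plane" using x by (simp add: hyp_plane_def)
  then have "hyp_speed (hyp_polar x s) \<theta> = hyp_speed (\<lambda>\<theta>. of_real ?T * cis \<theta>) \<theta>"
    using hyp_speed_Moebius[OF _ tanh_cis_in_hyp_plane differentiableI_vector[OF D]]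
    by (simp add: hyp_polar_def[abs_def] o_def)
  also have "\<dots> = 2 / (1 - ?T\<^sup>2) * ?T"
    using vector_derivative_at[OF D] s by (simp add: hyp_speed_def norm_mult)
  also have "\<dots> = 2 * sinh (s / 2) * cosh (s / 2)"
  proof -
    have "cosh (s / 2) \<noteq> 0" by (metis cosh_real_nonzero)
    moreover have "1 - ?T\<^sup>2 = 1 / (cosh (s / 2))\<^sup>2"
      using calculation by (simp add: tanh_def power_divide sinh_square_eq diff_divide_distrib)
    ultimately show ?thesis by (simp add: tanh_def power2_eq_square)
  qed
  also have "\<dots> = sinh s"
    using sinh_double[of "s / 2"] by simp
  finally show ?thesis .
qed

lemma hyp_length_hyp_polar:
  assumes "x \<in> hyp_plane" "0 \<le> s"
  shows "hyp_length (hyp_polar x s) 0 (2 * pi) = 2 * pi * sinh s"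
  using assms by (simp add: hyp_arc_integral_def hyp_speed_hyp_polar)

end

theory Submission
  imports Defs "HOL-Real_Asymp.Real_Asymp"
begin

text \<open>Finite-time blow-up is proved by contradiction, through pointwise lower bounds for a global
  solution \<open>U\<close>. Write \<open>r\<close> for the distance of \<open>x\<close> from the origin and \<open>\<xi> = t - r\<close>.

  The mechanism is as follows. A linear wave on the hyperbolic plane has size \<open>exp (- r / 2)\<close> near
  the light cone, so one puts \<open>U = exp (- r / 2) v\<close> and follows \<open>v\<close>, which behaves like a solution
  of the one-dimensional wave equation. Where \<open>U\<close> is at least \<open>exp (- L)\<close>, the source \<open>F U\<close> is at
  least \<open>L powr (1 - p) * U\<close> up to a constant, whether \<open>U\<close> is small or large. As
  \<open>U\<close> is only exponentially small in time, \<open>v\<close> sees a potential of size \<open>t powr (1 - p)\<close>. Integrating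
  it over a region of the \<open>(t, r)\<close> half-plane whose two side lengths are comparable to \<open>\<xi>\<close>
  multiplies \<open>v\<close> by \<open>\<xi> powr (3 - p)\<close>, and \<open>3 - p > 0\<close>. The data make \<open>v\<close> bounded below in a strip
  along the cone, hence \<open>v \<ge> C * \<xi> powr (2 - p)\<close> in the region \<open>\<xi> \<le> 2 * r\<close>, and repeating the
  argument gives every power of \<open>\<xi>\<close> there. One last application carries the
  growth into the annulus \<open>1 \<le> r \<le> 2\<close>, where the factor \<open>exp (- r / 2)\<close> is harmless, so that \<open>U\<close>
  tends to infinity there. Once \<open>U\<close> is large on the annulus for all later times, the bound
  \<open>F U \<ge> c * U powr q\<close> with \<open>q > 1\<close> amplifies it infinitely often within one unit of time, which is
  absurd.

  All these bounds are pointwise in \<open>x\<close> and pass through the integrals because the kernel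
  is positive. The kernel enters through two facts. First, up to the factor
  \<open>2 * sinh (s / 2)\<close>, \<open>wave_I\<close> averages circle means over a fixed compact parameter interval with
  a continuous integrand
  (\<open>wave_I_eq_integral_over_unit_interval\<close>); this gives the integrability of the Duhamel term and
  shows that radii close to \<open>s\<close> carry mass of order \<open>exp (s / 2)\<close> (\<open>wave_I_lower_bound\<close>).
  Second, along a circle the distance to the origin varies at a controlled rate
  (\<open>polar_jacobian_bound\<close>), so the circle mean of a function bounded below on a shell is at least
  a multiple of the thickness of the shell (\<open>circle_mean_lower_bound\<close>). Together they give
  \<open>wave_I_shell\<close>, which replaces the kernel of the one-dimensional wave equation. The
  growth of \<open>v\<close> is \<open>interior_growth_base\<close> and \<open>interior_growth_step\<close>, the passage to the annulus is
  \<open>central_growth\<close>, and the final amplification is \<open>no_global_solution\<close>.\<close>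

section \<open>Distances from the origin along geodesic circles\<close>

lemma cosh_sinh_two_artanh:
  fixes a :: real assumes "\<bar>a\<bar> < 1"
  shows "cosh (2 * artanh a) = (1 + a\<^sup>2) / (1 - a\<^sup>2)" "sinh (2 * artanh a) = 2 * a / (1 - a\<^sup>2)"
proof -
  have pos: "1 + a > 0" "1 - a > 0" using assms by auto
  then have nz: "1 - a\<^sup>2 \<noteq> 0"
    using assms by (auto simp: abs_square_eq_1 power2_eq_1_iff)
  have E: "exp (2 * artanh a) = (1 + a) / (1 - a)" "exp (- (2 * artanh a)) = (1 - a) / (1 + a)"
    using pos by (simp_all add: artanh_def exp_minus)
  show "cosh (2 * artanh a) = (1 + a\<^sup>2) / (1 - a\<^sup>2)" "sinh (2 * artanh a) = 2 * a / (1 - a\<^sup>2)"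
    unfolding cosh_field_def sinh_field_def E using pos nz
    by (simp_all add: divide_simps) (simp_all add: power2_eq_square algebra_simps)
qed

lemma cosh_sinh_hyp_dist_0:
  assumes "y \<in> hyp_plane"
  shows "cosh (hyp_dist 0 y) = (1 + (norm y)\<^sup>2) / (1 - (norm y)\<^sup>2)"
    and "sinh (hyp_dist 0 y) = 2 * norm y / (1 - (norm y)\<^sup>2)"
    and "0 \<le> hyp_dist 0 y"
proof -
  have 0: "(0::complex) \<in> hyp_plane" by (simp add: hyp_plane_def)
  have y: "norm y < 1" using assms by (simp add: hyp_plane_def)
  have d: "hyp_dist 0 y = 2 * artanh (norm y)"
    using hyp_dist_eq[OF 0 assms] by (simp add: Moebius_function_def)
  show "cosh (hyp_dist 0 y) = (1 + (norm y)\<^sup>2) / (1 - (norm y)\<^sup>2)"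
    "sinh (hyp_dist 0 y) = 2 * norm y / (1 - (norm y)\<^sup>2)"
    unfolding d using y by (simp_all add: cosh_sinh_two_artanh)
  have "0 \<le> sinh (hyp_dist 0 y)"
    unfolding \<open>sinh (hyp_dist 0 y) = _\<close> using y
    by (intro divide_nonneg_nonneg) (auto simp: power_le_one less_imp_le)
  then show "0 \<le> hyp_dist 0 y" by simp
qed

lemma hyp_law_of_cosines:
  assumes x: "x \<in> hyp_plane"
  shows "cosh (hyp_dist 0 (hyp_polar x s \<theta>)) =
    cosh (hyp_dist 0 x) * cosh s + sinh (hyp_dist 0 x) * sinh s * cos (\<theta> - Arg2pi x)"
proof -
  define a where "a = norm x"
  define T where "T = tanh (s / 2)"
  define z where "z = of_real T * cis \<theta>"
  have T: "\<bar>T\<bar> < 1" using tanh_real_bounds[of "s/2"] by (auto simp: T_def)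
  have cs: "cosh s = (1 + T\<^sup>2) / (1 - T\<^sup>2)" "sinh s = 2 * T / (1 - T\<^sup>2)"
    using cosh_sinh_two_artanh[OF T] by (simp_all add: T_def artanh_tanh_real)
  have x': "-x \<in> hyp_plane" using x by (simp add: hyp_plane_def)
  have z: "z \<in> hyp_plane" unfolding z_def T_def by (rule tanh_cis_in_hyp_plane)
  have nz: "norm z = \<bar>T\<bar>" by (simp add: z_def norm_mult)
  have w: "hyp_polar x s \<theta> = Moebius_function 0 (-x) z"
    by (simp add: hyp_polar_def z_def T_def)
  have xa: "x = of_real a * cis (Arg2pi x)"
    using Arg2pi_eq[of x] by (simp add: a_def cis_conv_exp mult.commute)
  define N where "N = (norm (1 + cnj x * z))\<^sup>2"
  define P where "P = (norm (z + x))\<^sup>2"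
  have "N \<noteq> 0" using hyp_plane_denom[OF x' z] by (simp add: N_def)
  have W: "(norm (hyp_polar x s \<theta>))\<^sup>2 = P / N"
    unfolding w by (simp add: Moebius_function_def norm_divide power_divide P_def N_def)
  \<comment> \<open>The claim is \<open>cosh d = (N + P) / (N - P)\<close>; the cross term \<open>2 * Re (cnj x * z)\<close> cancels in
    the denominator and gives the cosine in the numerator.\<close>
  have re: "Re (cnj x * z) = a * T * cos (\<theta> - Arg2pi x)"
    by (subst xa) (simp add: z_def cos_diff algebra_simps)
  have n1: "N = 1 + a\<^sup>2 * T\<^sup>2 + 2 * Re (cnj x * z)"
  proof -
    have "N = 1 + (norm (cnj x * z))\<^sup>2 + 2 * Re (cnj x * z)"
      unfolding N_def cmod_power2 by (simp add: algebra_simps power2_eq_square)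
    then show ?thesis by (simp add: norm_mult power_mult_distrib nz a_def)
  qed
  have p1: "P = a\<^sup>2 + T\<^sup>2 + 2 * Re (cnj x * z)"
  proof -
    have "P = (norm x)\<^sup>2 + (norm z)\<^sup>2 + 2 * Re (cnj x * z)"
      unfolding P_def cmod_power2 by (simp add: algebra_simps power2_eq_square)
    then show ?thesis by (simp add: nz a_def)
  qed
  have "a\<^sup>2 < 1" "T\<^sup>2 < 1"
    using x T by (auto simp: a_def hyp_plane_def abs_square_less_1)
  have "N - P = (1 - a\<^sup>2) * (1 - T\<^sup>2)" unfolding n1 p1 by (simp add: algebra_simps)
  have "cosh (hyp_dist 0 (hyp_polar x s \<theta>)) = (1 + P / N) / (1 - P / N)"
    using cosh_sinh_hyp_dist_0(1)[OF hyp_polar_in_hyp_plane[OF x]] by (simp add: W)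
  also have "\<dots> = (N + P) / (N - P)"
    using \<open>N \<noteq> 0\<close> by (simp add: divide_simps)
  also have "\<dots> = ((1 + a\<^sup>2) * (1 + T\<^sup>2) + 2 * a * (2 * T) * cos (\<theta> - Arg2pi x)) / ((1 - a\<^sup>2) * (1 - T\<^sup>2))"
    unfolding \<open>N - P = _\<close> unfolding n1 p1 re by (simp add: algebra_simps)
  also have "\<dots> = cosh (hyp_dist 0 x) * cosh s + sinh (hyp_dist 0 x) * sinh s * cos (\<theta> - Arg2pi x)"
    unfolding cosh_sinh_hyp_dist_0[OF x] cs a_def[symmetric]
    using \<open>a\<^sup>2 < 1\<close> \<open>T\<^sup>2 < 1\<close> by (simp add: divide_simps)
  finally show ?thesis .
qed

lemma continuous_on_hyp_polar:
  assumes x: "x \<in> hyp_plane" and "continuous_on A r" "continuous_on A \<theta>"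
  shows "continuous_on A (\<lambda>z. hyp_polar x (r z) (\<theta> z))"
proof -
  have x': "-x \<in> hyp_plane" using x by (simp add: hyp_plane_def)
  have "1 + cnj x * (of_real (tanh (r z / 2)) * cis (\<theta> z)) \<noteq> 0" for z
    using hyp_plane_denom[OF x' tanh_cis_in_hyp_plane] by simp
  then show ?thesis
    unfolding hyp_polar_def Moebius_function_def
    using assms(2,3) by (auto intro!: continuous_intros)
qed

text \<open>The mean over the geodesic circle in terms of the polar angle. Unlike \<^const>\<open>hyp_mean\<close>, it has the
  right value \<open>f x\<close> at radius \<open>0\<close>, so it is continuous in the radius up to the centre.\<close>

definition circle_mean :: "(complex \<Rightarrow> real) \<Rightarrow> complex \<Rightarrow> real \<Rightarrow> real" where
  "circle_mean f x s = integral {0..2 * pi} (\<lambda>\<theta>. f (hyp_polar x s \<theta>)) / (2 * pi)"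

lemma hyp_mean_eq_circle_mean:
  assumes "x \<in> hyp_plane" "0 < s"
  shows "hyp_mean s f x = circle_mean f x s"
proof -
  have "integral {0..2 * pi} (\<lambda>\<theta>. f (hyp_polar x s \<theta>) * sinh s)
    = sinh s * integral {0..2 * pi} (\<lambda>\<theta>. f (hyp_polar x s \<theta>))"
    by (subst mult.commute) simp
  then show ?thesis
    using assms
    by (simp add: hyp_mean_def circle_mean_def hyp_length_hyp_polar hyp_arc_integral_def[of _ _ _ f]
      hyp_speed_hyp_polar)
qed

lemma continuous_on_circle_mean:
  fixes f :: "'a::metric_space \<Rightarrow> complex \<Rightarrow> real"
  assumes x: "x \<in> hyp_plane" and f: "continuous_on (A \<times> hyp_plane) (\<lambda>(z, y). f z y)"
    and s: "continuous_on A s"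
  shows "continuous_on A (\<lambda>z. circle_mean (f z) x (s z))"
proof -
  have 1: "continuous_on (A \<times> {0..2*pi}) (\<lambda>(z, \<theta>). f z (hyp_polar x (s z) \<theta>))"
  proof -
    have c: "continuous_on (A \<times> {0..2*pi}) (\<lambda>q. (fst q, hyp_polar x (s (fst q)) (snd q)))"
      by (intro continuous_intros continuous_on_hyp_polar x continuous_on_compose2[OF s]) auto
    have i: "(\<lambda>q. (fst q, hyp_polar x (s (fst q)) (snd q))) ` (A \<times> {0..2*pi}) \<subseteq> A \<times> hyp_plane"
      using hyp_polar_in_hyp_plane[OF x] by auto
    show ?thesis
      using continuous_on_compose2[OF f c i] by (simp add: case_prod_beta)
  qed
  have "continuous_on A (\<lambda>z. integral {0..2 * pi} (\<lambda>\<theta>. f z (hyp_polar x (s z) \<theta>)))"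
    using integral_continuous_on_param[of A 0 "2*pi" "\<lambda>z \<theta>. f z (hyp_polar x (s z) \<theta>)"] 1
    by simp
  then show ?thesis
    unfolding circle_mean_def by (intro continuous_intros) auto
qed

lemma circle_mean_integrand_continuous:
  assumes "x \<in> hyp_plane" "continuous_on hyp_plane f"
  shows "continuous_on A (\<lambda>\<theta>. f (hyp_polar x s \<theta>))"
  by (rule continuous_on_compose2[OF assms(2)])
     (auto intro!: continuous_on_hyp_polar continuous_intros hyp_polar_in_hyp_plane assms)

lemma circle_mean_nonneg:
  assumes "x \<in> hyp_plane" "continuous_on hyp_plane f" "\<And>y. y \<in> hyp_plane \<Longrightarrow> 0 \<le> f y"
  shows "0 \<le> circle_mean f x s"
  unfolding circle_mean_def
  by (intro divide_nonneg_pos integral_nonneg integrable_continuous_interval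
      circle_mean_integrand_continuous) (use assms hyp_polar_in_hyp_plane in auto)

text \<open>Along the circle of radius \<open>s\<close> around a point at distance \<open>r\<close> from the origin, with \<open>k\<close> the cosine
  of the polar angle, the derivative of \<open>cosh \<rho>\<close> with respect to the angle has the square on the left.
  By the law of cosines it equals \<open>(cosh s - cosh (r - \<rho>)) * (cosh (r + \<rho>) - cosh s)\<close>,
  an expression symmetric in the three side lengths.\<close>

lemma polar_jacobian_bound:
  fixes r s \<rho> k :: real
  assumes "0 \<le> r" "0 \<le> s" "0 \<le> \<rho>" and k: "cosh \<rho> = cosh r * cosh s + sinh r * sinh s * k"
  shows "(sinh r * sinh s)\<^sup>2 * (1 - k\<^sup>2) \<le> (cosh s - 1) * cosh (r + \<rho>)"
proof -
  define f1 f2 where "f1 = cosh s - cosh (r - \<rho>)" and "f2 = cosh (r + \<rho>) - cosh s"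
  have sq: "(sinh r)\<^sup>2 = (cosh r)\<^sup>2 - 1" "(sinh s)\<^sup>2 = (cosh s)\<^sup>2 - 1" "(sinh \<rho>)\<^sup>2 = (cosh \<rho>)\<^sup>2 - 1"
    by (simp_all add: sinh_square_eq)
  have "(sinh r * sinh s)\<^sup>2 * (1 - k\<^sup>2) = (sinh r)\<^sup>2 * (sinh s)\<^sup>2 - (cosh \<rho> - cosh r * cosh s)\<^sup>2"
    unfolding k by (simp add: algebra_simps power2_eq_square)
  also have "\<dots> = (sinh r)\<^sup>2 * (sinh \<rho>)\<^sup>2 - (cosh s - cosh r * cosh \<rho>)\<^sup>2"
    unfolding sq by (simp add: algebra_simps power2_eq_square)
  also have "\<dots> = f1 * f2"
    unfolding f1_def f2_def cosh_add cosh_diff by (simp add: algebra_simps power2_eq_square)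
  also have "\<dots> \<le> (cosh s - 1) * cosh (r + \<rho>)"
  proof (cases "f1 \<ge> 0")
    case True
    have "f2 \<le> cosh (r + \<rho>)" "f1 \<le> cosh s - 1" "0 \<le> cosh (r + \<rho>)"
      using cosh_real_ge_1[of "r - \<rho>"] cosh_real_ge_1[of "r + \<rho>"] cosh_real_ge_1[of s]
      by (auto simp: f1_def f2_def)
    then show ?thesis using True by (meson mult_left_mono mult_right_mono order_trans)
  next
    case False
    have "f1 + f2 = 2 * (sinh r * sinh \<rho>)" by (simp add: f1_def f2_def cosh_add cosh_diff)
    then have "f2 \<ge> 0" using False assms by (smt (verit) mult_nonneg_nonneg sinh_real_nonneg_iff)
    then have "f1 * f2 \<le> 0" using False by (simp add: mult_nonpos_nonneg)
    also have "0 \<le> (cosh s - 1) * cosh (r + \<rho>)"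
      using cosh_real_ge_1[of s] cosh_real_ge_1[of "r + \<rho>"] by simp
    finally show ?thesis .
  qed
  finally show ?thesis .
qed

text \<open>The cosine runs monotonically through \<open>{k1..k2}\<close> on either side of \<open>\<alpha>\<close>; at least one of the two
  half turns starting at \<open>\<alpha>\<close> stays inside \<open>{0..2 * pi}\<close>, and the sign \<open>e\<close> records which one was
  used.\<close>

lemma half_turn_parametrisation:
  fixes \<alpha> k1 k2 :: real
  assumes "0 \<le> \<alpha>" "\<alpha> < 2 * pi" "-1 \<le> k1" "k1 \<le> k2" "k2 \<le> 1"
  obtains a b e where "0 \<le> a" "a \<le> b" "b \<le> 2 * pi" "\<bar>e\<bar> = 1"
    "\<And>\<theta>. \<theta> \<in> {a..b} \<Longrightarrow> cos (\<theta> - \<alpha>) \<in> {k1..k2}"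
    "\<And>R::real \<Rightarrow> real. e * (R (cos (b - \<alpha>)) - R (cos (a - \<alpha>))) = R k2 - R k1"
proof -
  define p1 p2 where "p1 = arccos k1" and "p2 = arccos k2"
  have p: "0 \<le> p2" "p2 \<le> p1" "p1 \<le> pi" "cos p1 = k1" "cos p2 = k2"
    using assms by (auto simp: p1_def p2_def arccos_lbound arccos_ubound arccos_le_arccos cos_arccos)
  have c: "cos \<phi> \<in> {k1..k2}" if "p2 \<le> \<phi>" "\<phi> \<le> p1" for \<phi>
    using cos_monotone_0_pi_le[of p2 \<phi>] cos_monotone_0_pi_le[of \<phi> p1] p that by auto
  show thesis
  proof (cases "\<alpha> \<le> pi")
    case True
    show thesis
    proof (rule that[of "\<alpha> + p2" "\<alpha> + p1" "-1"])
      fix \<theta> assume "\<theta> \<in> {\<alpha> + p2..\<alpha> + p1}"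
      then show "cos (\<theta> - \<alpha>) \<in> {k1..k2}" by (intro c) auto
    qed (use True p assms in auto)
  next
    case False
    show thesis
    proof (rule that[of "\<alpha> - p1" "\<alpha> - p2" "1"])
      fix \<theta> assume "\<theta> \<in> {\<alpha> - p1..\<alpha> - p2}"
      then have "cos (\<alpha> - \<theta>) \<in> {k1..k2}" by (intro c) auto
      then show "cos (\<theta> - \<alpha>) \<in> {k1..k2}" using cos_minus[of "\<theta> - \<alpha>"] by simp
    qed (use False p assms in auto)
  qed
qed

text \<open>Over half of the circle the distance \<open>\<rho>\<close> to the origin moves monotonically between \<open>\<bar>r - s\<bar>\<close> and
  \<open>r + s\<close>, at rate at most \<open>sqrt ((cosh s - 1) * cosh (r + \<rho>)) / sinh \<rho>\<close> per unit of angle. A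
  function that dominates \<open>C\<close> times this rate on the shell therefore has an angular integral of at
  least \<open>C\<close> times the variation of \<open>\<rho>\<close>, which is the thickness of the shell. Stating the
  hypothesis with the rate instead of a constant lets the bound keep its sharp dependence on
  \<open>\<rho>\<close> and on small \<open>s\<close>.\<close>

lemma circle_mean_lower_bound:
  fixes r s \<rho>1 \<rho>2 C :: real
  assumes x: "x \<in> hyp_plane" and r: "r = hyp_dist 0 x" "0 < r" and s: "0 < s"
    and \<rho>: "0 < \<rho>1" "\<rho>1 \<le> \<rho>2" "\<bar>r - s\<bar> \<le> \<rho>1" "\<rho>2 \<le> r + s"
    and f: "continuous_on hyp_plane f" "\<And>y. y \<in> hyp_plane \<Longrightarrow> 0 \<le> f y" and C: "0 \<le> C"
    and low: "\<And>y. y \<in> hyp_plane \<Longrightarrow> hyp_dist 0 y \<in> {\<rho>1..\<rho>2} \<Longrightarrow>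
      C * sqrt ((cosh s - 1) * cosh (r + hyp_dist 0 y)) \<le> f y * sinh (hyp_dist 0 y)"
  shows "C * (\<rho>2 - \<rho>1) / (2 * pi) \<le> circle_mean f x s"
proof -
  define \<alpha> where "\<alpha> = Arg2pi x"
  define S where "S = sinh r * sinh s"
  have S: "S > 0" using r s by (simp add: S_def)
  define k where "k \<rho> = (cosh \<rho> - cosh r * cosh s) / S" for \<rho>
  have ck: "cosh r * cosh s + S * k \<rho> = cosh \<rho>" for \<rho> using S by (simp add: k_def)
  have "cosh (\<bar>r - s\<bar>) \<le> cosh \<rho>1" using \<rho> by (subst cosh_real_nonneg_le_iff) auto
  then have "cosh r * cosh s - S \<le> cosh \<rho>1" by (simp add: cosh_diff S_def)
  then have k1: "-1 \<le> k \<rho>1" using S by (simp add: k_def divide_simps)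
  have "cosh \<rho>2 \<le> cosh (r + s)" using \<rho> by (subst cosh_real_nonneg_le_iff) auto
  then have "cosh \<rho>2 \<le> cosh r * cosh s + S" by (simp add: cosh_add S_def)
  then have k2: "k \<rho>2 \<le> 1" using S by (simp add: k_def divide_simps)
  have "cosh \<rho>1 \<le> cosh \<rho>2" using \<rho> by (subst cosh_real_nonneg_le_iff) auto
  then have k12: "k \<rho>1 \<le> k \<rho>2" using S by (simp add: k_def divide_simps)
  define Z where "Z c = cosh r * cosh s + S * c" for c
  obtain a b e where ab: "0 \<le> a" "a \<le> b" "b \<le> 2 * pi" and e: "\<bar>e\<bar> = 1"
    and cos: "\<And>\<theta>. \<theta> \<in> {a..b} \<Longrightarrow> cos (\<theta> - \<alpha>) \<in> {k \<rho>1..k \<rho>2}"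
    and eR: "\<And>R::real \<Rightarrow> real. e * (R (cos (b - \<alpha>)) - R (cos (a - \<alpha>))) = R (k \<rho>2) - R (k \<rho>1)"
    using half_turn_parametrisation[OF _ _ k1 k12 k2, of \<alpha>] Arg2pi[of x] unfolding \<alpha>_def by metis
  define R where "R \<theta> = arcosh (Z (cos (\<theta> - \<alpha>)))" for \<theta>
  define R' where "R' \<theta> = - S * sin (\<theta> - \<alpha>) / sinh (R \<theta>)" for \<theta>
  have Zb: "cosh \<rho>1 \<le> Z (cos (\<theta> - \<alpha>))" "Z (cos (\<theta> - \<alpha>)) \<le> cosh \<rho>2" if "\<theta> \<in> {a..b}" for \<theta>
    using cos[OF that] S unfolding Z_def ck[of \<rho>1, symmetric] ck[of \<rho>2, symmetric] by auto
  have Z1: "1 < Z (cos (\<theta> - \<alpha>))" if "\<theta> \<in> {a..b}" for \<theta>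
    using Zb[OF that] \<rho>(1) cosh_real_strict_mono[of 0 \<rho>1] by auto
  have coshR: "cosh (R \<theta>) = Z (cos (\<theta> - \<alpha>))" if "\<theta> \<in> {a..b}" for \<theta>
    using Z1[OF that] by (simp add: R_def cosh_arcosh_real)
  have Rnn: "0 \<le> R \<theta>" if "\<theta> \<in> {a..b}" for \<theta>
    using Z1[OF that] by (simp add: R_def)
  have Rb: "R \<theta> \<in> {\<rho>1..\<rho>2}" if "\<theta> \<in> {a..b}" for \<theta>
    using Zb[OF that] Rnn[OF that] \<rho> unfolding coshR[OF that, symmetric]
    by (auto simp: cosh_real_nonneg_le_iff)
  have dist: "hyp_dist 0 (hyp_polar x s \<theta>) = R \<theta>" if "\<theta> \<in> {a..b}" for \<theta>
  proof -
    have "cosh (hyp_dist 0 (hyp_polar x s \<theta>)) = cosh (R \<theta>)"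
      unfolding coshR[OF that] hyp_law_of_cosines[OF x] by (simp add: Z_def S_def r(1) \<alpha>_def)
    then show ?thesis
      using cosh_sinh_hyp_dist_0(3)[OF hyp_polar_in_hyp_plane[OF x]] Rnn[OF that]
      by (metis arcosh_cosh_real)
  qed
  have deriv: "(R has_field_derivative R' \<theta>) (at \<theta> within {a..b})" if "\<theta> \<in> {a..b}" for \<theta>
  proof -
    have "sinh (R \<theta>) = sqrt ((Z (cos (\<theta> - \<alpha>)))\<^sup>2 - 1)"
      using Z1[OF that] by (simp add: R_def sinh_arcosh_real)
    then have R'_eq: "R' \<theta> = 1 / sqrt ((Z (cos (\<theta> - \<alpha>)))\<^sup>2 - 1) * (- S * sin (\<theta> - \<alpha>))"
      by (simp add: R'_def)
    have "((\<lambda>\<theta>. Z (cos (\<theta> - \<alpha>))) has_field_derivative - S * sin (\<theta> - \<alpha>)) (at \<theta> within {a..b})"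
      unfolding Z_def by (auto intro!: derivative_eq_intros)
    from arcosh_real_has_field_derivative[OF Z1[OF that], where A = UNIV] this
    show ?thesis unfolding R_def[abs_def] R'_eq by (rule DERIV_chain2)
  qed
  \<comment> \<open>The total variation of \<open>R\<close> over the half turn is the thickness of the shell.\<close>
  have "((\<lambda>\<theta>. C * (e * R' \<theta>)) has_integral C * (e * (R b - R a))) {a..b}"
    by (intro has_integral_mult_right fundamental_theorem_of_calculus ab)
       (use deriv in \<open>simp add: has_real_derivative_iff_has_vector_derivative\<close>)
  moreover have "e * (R b - R a) = \<rho>2 - \<rho>1"
    using eR[of "\<lambda>c. arcosh (Z c)"] \<rho> by (simp add: R_def Z_def ck arcosh_cosh_real)
  ultimately have int: "((\<lambda>\<theta>. C * (e * R' \<theta>)) has_integral C * (\<rho>2 - \<rho>1)) {a..b}"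
    by simp
  have fint: "(\<lambda>\<theta>. f (hyp_polar x s \<theta>)) integrable_on {u..v}" for u v
    by (intro integrable_continuous_interval circle_mean_integrand_continuous x f)
  have "C * (\<rho>2 - \<rho>1) \<le> integral {a..b} (\<lambda>\<theta>. f (hyp_polar x s \<theta>))"
  proof (rule has_integral_le[OF int integrable_integral[OF fint]])
    fix \<theta> assume \<theta>: "\<theta> \<in> {a..b}"
    have sR: "sinh (R \<theta>) > 0" using Rb[OF \<theta>] \<rho> by simp
    have "cosh (R \<theta>) = cosh r * cosh s + sinh r * sinh s * cos (\<theta> - \<alpha>)"
      using coshR[OF \<theta>] by (simp add: Z_def S_def)
    from polar_jacobian_bound[OF _ _ Rnn[OF \<theta>] this]
    have "(S * sin (\<theta> - \<alpha>))\<^sup>2 \<le> (cosh s - 1) * cosh (r + R \<theta>)"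
      using r s by (simp add: S_def power_mult_distrib cos_squared_eq)
    then have "\<bar>S * sin (\<theta> - \<alpha>)\<bar> \<le> sqrt ((cosh s - 1) * cosh (r + R \<theta>))"
      by (metis real_sqrt_abs real_sqrt_le_iff)
    then have "C * \<bar>S * sin (\<theta> - \<alpha>)\<bar> \<le> C * sqrt ((cosh s - 1) * cosh (r + R \<theta>))"
      using C by (rule mult_left_mono)
    also have "\<dots> \<le> f (hyp_polar x s \<theta>) * sinh (R \<theta>)"
      using low[OF hyp_polar_in_hyp_plane[OF x], of s \<theta>] Rb[OF \<theta>] by (simp add: dist[OF \<theta>])
    finally have "C * (\<bar>S * sin (\<theta> - \<alpha>)\<bar> / sinh (R \<theta>)) \<le> f (hyp_polar x s \<theta>)"
      using sR by (simp add: divide_simps)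
    moreover have "e * R' \<theta> \<le> \<bar>S * sin (\<theta> - \<alpha>)\<bar> / sinh (R \<theta>)"
    proof -
      have "\<bar>e * R' \<theta>\<bar> = \<bar>S * sin (\<theta> - \<alpha>)\<bar> / sinh (R \<theta>)"
        using sR e by (simp add: R'_def abs_mult)
      then show ?thesis by linarith
    qed
    ultimately show "C * (e * R' \<theta>) \<le> f (hyp_polar x s \<theta>)"
      using C by (meson mult_left_mono order_trans)
  qed
  also have "\<dots> \<le> integral {0..2 * pi} (\<lambda>\<theta>. f (hyp_polar x s \<theta>))"
    by (rule integral_subset_le) (use ab fint f(2) hyp_polar_in_hyp_plane[OF x] in auto)
  finally show ?thesis unfolding circle_mean_def by (simp add: divide_right_mono)
qed

section \<open>The linear propagator as an integral over a compact interval\<close>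

text \<open>The substitution \<open>w = sqrt (2 * cosh s - 2 * cosh \<sigma>) / (2 * sinh (s / 2))\<close> absorbs the
  singular kernel of \<^const>\<open>wave_I\<close>: it maps the radii \<open>\<sigma> \<in> {0..s}\<close> decreasingly onto \<open>{0..1}\<close>, and
  \<open>cone_radius s\<close> is its inverse.\<close>

definition cone_radius :: "real \<Rightarrow> real \<Rightarrow> real" where
  "cone_radius s w = 2 * arsinh (sinh (s / 2) * sqrt (1 - w\<^sup>2))"

definition cone_param :: "real \<Rightarrow> real \<Rightarrow> real" where
  "cone_param s \<sigma> = sqrt (2 * cosh s - 2 * cosh \<sigma>) / (2 * sinh (s / 2))"

lemma cosh_half: "cosh (s::real) = 1 + 2 * (sinh (s / 2))\<^sup>2"
  using cosh_double[of "s / 2"] by (simp add: cosh_square_eq)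

lemma cone_radius_param:
  assumes "0 < s" "0 \<le> \<sigma>" "\<sigma> \<le> s"
  shows "cone_radius s (cone_param s \<sigma>) = \<sigma>"
proof -
  have sp: "sinh (s / 2) > 0" using assms by simp
  have "cosh \<sigma> \<le> cosh s" using assms by (simp add: cosh_real_nonneg_le_iff)
  then have "(cone_param s \<sigma>)\<^sup>2 = (2 * cosh s - 2 * cosh \<sigma>) / (4 * (sinh (s / 2))\<^sup>2)"
    by (simp add: cone_param_def power_divide power_mult_distrib)
  also have "\<dots> = 1 - (sinh (\<sigma> / 2))\<^sup>2 / (sinh (s / 2))\<^sup>2"
    using sp by (simp add: cosh_half[of s] cosh_half[of \<sigma>] field_simps)
  finally have "sqrt (1 - (cone_param s \<sigma>)\<^sup>2) = sinh (\<sigma> / 2) / sinh (s / 2)"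
    using sp assms by (simp add: real_sqrt_divide)
  then show ?thesis using sp by (simp add: cone_radius_def arsinh_sinh_real)
qed

lemma cone_param_bounds:
  assumes "0 < s" "0 \<le> \<sigma>" "\<sigma> \<le> s"
  shows "0 \<le> cone_param s \<sigma>" "cone_param s \<sigma> \<le> 1"
proof -
  have "cosh \<sigma> \<le> cosh s" using assms by (simp add: cosh_real_nonneg_le_iff)
  then show "0 \<le> cone_param s \<sigma>" using assms by (simp add: cone_param_def)
  have "sqrt (2 * cosh s - 2 * cosh \<sigma>) \<le> 2 * sinh (s / 2)"
    using assms by (intro real_le_lsqrt) (simp_all add: cosh_half[of s] cosh_half[of \<sigma>] power_mult_distrib)
  then show "cone_param s \<sigma> \<le> 1"
    using assms by (simp add: cone_param_def)
qed

lemma cone_radius_continuous: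
  assumes "continuous_on A a" "continuous_on A b"
  shows "continuous_on A (\<lambda>z. cone_radius (a z) (b z))"
  unfolding cone_radius_def
  by (intro continuous_on_mult continuous_on_const continuous_on_compose2[OF continuous_on_arsinh[of UNIV]])
     (auto intro!: continuous_intros assms)

lemma circle_mean_cone_continuous:
  assumes x: "x \<in> hyp_plane" and f: "continuous_on hyp_plane f"
  shows "continuous_on A (\<lambda>w. circle_mean f x (cone_radius s w))"
  using f by (intro continuous_on_circle_mean[where f = "\<lambda>_. f"] x cone_radius_continuous)
     (auto intro!: continuous_intros continuous_on_compose2[OF f] simp: case_prod_beta)

text \<open>The kernel is minus the derivative of \<open>2 * sinh (s / 2) * cone_param s\<close>, so only the
  continuous circle mean is left under the integral, over an interval that does not depend on \<open>s\<close>.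
  The singularity at \<open>\<sigma> = s\<close> is one exceptional point of the substitution, and at \<open>\<sigma> = 0\<close>, where
  \<^const>\<open>hyp_mean\<close> is the quotient \<open>0 / 0\<close>, the kernel vanishes.\<close>

lemma wave_I_eq_integral_over_unit_interval:
  assumes x: "x \<in> hyp_plane" and f: "continuous_on hyp_plane f" and s: "0 \<le> s"
  shows "wave_I s x f = 2 * sinh (s / 2) * integral {0..1} (\<lambda>w. circle_mean f x (cone_radius s w))"
proof (cases "s = 0")
  case True then show ?thesis by (simp add: wave_I_def)
next
  case False
  with s have s: "0 < s" by simp
  have sp: "sinh (s / 2) > 0" using s by simp
  let ?k = "\<lambda>\<sigma>. sinh \<sigma> / sqrt (2 * cosh s - 2 * cosh \<sigma>)"
  let ?g' = "\<lambda>\<sigma>. - ?k \<sigma> / (2 * sinh (s / 2))"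
  note cm = circle_mean_cone_continuous[OF x f]
  have D: "(cone_param s has_field_derivative ?g' \<sigma>) (at \<sigma> within {0..s})" if "\<sigma> \<in> {0..s} - {s}" for \<sigma>
  proof -
    have "2 * cosh s - 2 * cosh \<sigma> > 0" using that by (simp add: cosh_real_nonneg_less_iff)
    then show ?thesis using sp unfolding cone_param_def[abs_def]
      by (auto intro!: derivative_eq_intros simp: field_simps)
  qed
  have "((\<lambda>\<sigma>. ?g' \<sigma> *\<^sub>R circle_mean f x (cone_radius s (cone_param s \<sigma>))) has_integral
     (integral {cone_param s 0..cone_param s s} (\<lambda>w. circle_mean f x (cone_radius s w))
      - integral {cone_param s s..cone_param s 0} (\<lambda>w. circle_mean f x (cone_radius s w)))) {0..s}"
  proof (rule has_integral_substitution_general[where s = "{s}" and c = 0 and d = 1])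
    show "cone_param s ` {0..s} \<subseteq> {0..1}" using cone_param_bounds[OF s] by auto
    show "continuous_on {0..s} (cone_param s)"
      unfolding cone_param_def[abs_def] using sp by (auto intro!: continuous_intros)
  qed (use s cm D in auto)
  moreover have "cone_param s s = 0" by (simp add: cone_param_def)
  moreover have "cone_param s 0 = 1"
    using sp by (simp add: cone_param_def cosh_half[of s] real_sqrt_mult)
  ultimately have "((\<lambda>\<sigma>. - (2 * sinh (s / 2)) * (?g' \<sigma> * circle_mean f x (cone_radius s (cone_param s \<sigma>))))
      has_integral - (2 * sinh (s / 2)) * (- integral {0..1} (\<lambda>w. circle_mean f x (cone_radius s w)))) {0..s}"
    by (intro has_integral_mult_right) auto
  moreover have "- (2 * sinh (s / 2)) * (?g' \<sigma> * circle_mean f x (cone_radius s (cone_param s \<sigma>)))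
      = ?k \<sigma> * hyp_mean \<sigma> f x" if "\<sigma> \<in> {0..s}" for \<sigma>
    using sp s that by (cases "\<sigma> = 0") (auto simp: hyp_mean_eq_circle_mean[OF x] cone_radius_param)
  ultimately have "((\<lambda>\<sigma>. ?k \<sigma> * hyp_mean \<sigma> f x) has_integral
      2 * sinh (s / 2) * integral {0..1} (\<lambda>w. circle_mean f x (cone_radius s w))) {0..s}"
    by (subst has_integral_cong[symmetric]) auto
  then show ?thesis unfolding wave_I_def by (rule integral_unique)
qed

lemma cone_radius_antimono:
  assumes "0 \<le> s" "w\<^sup>2 \<le> v\<^sup>2"
  shows "cone_radius s v \<le> cone_radius s w"
proof -
  have "sinh (s / 2) * sqrt (1 - v\<^sup>2) \<le> sinh (s / 2) * sqrt (1 - w\<^sup>2)"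
    using assms by (intro mult_left_mono) auto
  then show ?thesis unfolding cone_radius_def
    by (metis arsinh_less_iff_real linorder_not_le mult_le_cancel_left_pos zero_less_numeral)
qed

lemma wave_I_nonneg:
  assumes "x \<in> hyp_plane" "continuous_on hyp_plane f" "\<And>y. y \<in> hyp_plane \<Longrightarrow> 0 \<le> f y" "0 \<le> s"
  shows "0 \<le> wave_I s x f"
  unfolding wave_I_eq_integral_over_unit_interval[OF assms(1,2,4)]
  using assms by (intro mult_nonneg_nonneg integral_nonneg integrable_continuous_interval
      circle_mean_cone_continuous circle_mean_nonneg) auto

text \<open>Without this continuity, the Duhamel integral in \<^const>\<open>weak_solution\<close> could be the default
  value \<open>0\<close> of a non-integrable function, and no lower bound would follow from it.\<close>

lemma continuous_on_wave_I:
  assumes x: "x \<in> hyp_plane" and f: "continuous_on ({0..t} \<times> hyp_plane) (\<lambda>(\<tau>, y). f \<tau> y)"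
  shows "continuous_on {0..t} (\<lambda>\<tau>. wave_I (t - \<tau>) x (f \<tau>))"
proof -
  have f\<tau>: "continuous_on hyp_plane (f \<tau>)" if "\<tau> \<in> {0..t}" for \<tau>
  proof -
    have "continuous_on hyp_plane (\<lambda>y. (\<lambda>(\<tau>, y). f \<tau> y) (\<tau>, y))"
      by (rule continuous_on_compose2[OF f]) (use that in \<open>auto intro!: continuous_intros\<close>)
    then show ?thesis by simp
  qed
  have "continuous_on ({0..t} \<times> {0..1}) (\<lambda>z. circle_mean (f (fst z)) x (cone_radius (t - fst z) (snd z)))"
  proof (intro continuous_on_circle_mean[where f = "\<lambda>z. f (fst z)"] x cone_radius_continuous)
    have "continuous_on (({0..t} \<times> {0..1::real}) \<times> hyp_plane) (\<lambda>q. (\<lambda>(\<tau>, y). f \<tau> y) (fst (fst q), snd q))"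
      by (rule continuous_on_compose2[OF f]) (auto intro!: continuous_intros)
    then show "continuous_on (({0..t} \<times> {0..1::real}) \<times> hyp_plane) (\<lambda>(z, y). f (fst z) y)"
      by (simp add: case_prod_beta)
  qed (auto intro!: continuous_intros)
  then have "continuous_on {0..t} (\<lambda>\<tau>. integral {0..1} (\<lambda>w. circle_mean (f \<tau>) x (cone_radius (t - \<tau>) w)))"
    using integral_continuous_on_param[of "{0..t}" 0 1 "\<lambda>\<tau> w. circle_mean (f \<tau>) x (cone_radius (t - \<tau>) w)"]
    by (simp add: case_prod_beta)
  then have "continuous_on {0..t} (\<lambda>\<tau>. 2 * sinh ((t - \<tau>) / 2) *
      integral {0..1} (\<lambda>w. circle_mean (f \<tau>) x (cone_radius (t - \<tau>) w)))"
    by (intro continuous_intros) auto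
  then show ?thesis
    by (rule continuous_on_eq) (use wave_I_eq_integral_over_unit_interval[OF x f\<tau>] in auto)
qed

text \<open>The right-hand side is the mass that the kernel of \<^const>\<open>wave_I\<close> gives to the radii in
  \<open>{s - h..s}\<close>.\<close>

lemma cone_mass_lower_bound:
  assumes "0 < h" "h < (s::real)"
  shows "(1 - exp (- h)) * exp (s / 2) \<le> sqrt (2 * cosh s - 2 * cosh (s - h))"
proof (rule real_le_rsqrt)
  have "((1 - exp (- h)) * exp (s / 2))\<^sup>2 = (1 - exp (- h)) * (exp s - exp (s - h))"
    by (simp add: power2_eq_square algebra_simps flip: exp_add)
  also have "\<dots> \<le> (1 - exp (- h)) * (exp s - exp (h - s))"
    using assms by (intro mult_left_mono) auto
  also have "\<dots> = 2 * cosh s - 2 * cosh (s - h)"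
    by (simp add: cosh_field_def algebra_simps flip: exp_add)
  finally show "((1 - exp (- h)) * exp (s / 2))\<^sup>2 \<le> 2 * cosh s - 2 * cosh (s - h)" .
qed

text \<open>The radii in \<open>{s - h..s}\<close> correspond to the parameters in \<open>{0..cone_param s (s - h)}\<close>.\<close>

lemma wave_I_lower_bound:
  assumes x: "x \<in> hyp_plane" and f: "continuous_on hyp_plane f" "\<And>y. y \<in> hyp_plane \<Longrightarrow> 0 \<le> f y"
    and h: "0 < h" "h < s" and m: "0 \<le> m" "\<And>\<sigma>. \<sigma> \<in> {s - h..s} \<Longrightarrow> m \<le> circle_mean f x \<sigma>"
  shows "(1 - exp (- h)) * exp (s / 2) * m \<le> wave_I s x f"
proof -
  let ?M = "\<lambda>w. circle_mean f x (cone_radius s w)"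
  define w0 where "w0 = cone_param s (s - h)"
  have sp: "sinh (s / 2) > 0" using h by simp
  have w0: "0 \<le> w0" "w0 \<le> 1" "cone_radius s w0 = s - h"
    using cone_param_bounds[of s "s - h"] cone_radius_param[of s "s - h"] h by (auto simp: w0_def)
  have int: "?M integrable_on {a..b}" for a b
    by (intro integrable_continuous_interval circle_mean_cone_continuous x f)
  have "w0 * m = integral {0..w0} (\<lambda>_. m)" using w0 by simp
  also have "\<dots> \<le> integral {0..w0} ?M"
  proof (rule integral_le)
    fix w assume w: "w \<in> {0..w0}"
    then have "w\<^sup>2 \<le> w0\<^sup>2" by (simp add: power_mono)
    then have "cone_radius s w0 \<le> cone_radius s w" "cone_radius s w \<le> cone_radius s 0"
      using h by (auto intro!: cone_radius_antimono)
    moreover have "cone_radius s 0 = s" by (simp add: cone_radius_def arsinh_sinh_real)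
    ultimately show "m \<le> ?M w" using w0 by (intro m) auto
  qed (use int in auto)
  also have "\<dots> \<le> integral {0..1} ?M"
    by (rule integral_subset_le) (use w0 int circle_mean_nonneg[OF x f] in auto)
  finally have "2 * sinh (s / 2) * (w0 * m) \<le> wave_I s x f"
    using sp h by (simp add: wave_I_eq_integral_over_unit_interval[OF x f(1)])
  moreover have "2 * sinh (s / 2) * w0 = sqrt (2 * cosh s - 2 * cosh (s - h))"
    using sp by (simp add: w0_def cone_param_def)
  ultimately show ?thesis
    using mult_right_mono[OF cone_mass_lower_bound[OF h] m(1)] by (simp add: mult.assoc[symmetric])
qed

section \<open>Lower bounds for the linear propagator\<close>

definition shell_const :: "real \<Rightarrow> real" where
  "shell_const h = (1 - exp (- h)) * (1 - exp (- 2 * h)) / (4 * pi)"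

text \<open>The one-dimensional picture: up to the weight \<open>exp (- r / 2)\<close>, the propagator dominates a multiple of
  the integral over \<open>{\<bar>r - s\<bar>..r + s}\<close>. The margin \<open>h\<close> keeps the shell inside this
  interval for all radii in \<open>{s - h..s}\<close>, and only these are used. The powers of
  \<open>exp\<close> balance: the mass of those radii is of order \<open>exp (s / 2)\<close>, the circle mean of order
  \<open>exp (- (s + r) / 2)\<close>.\<close>

lemma wave_I_shell:
  fixes r s h \<rho> l A :: real
  assumes x: "x \<in> hyp_plane" and r: "r = hyp_dist 0 x" "0 < r"
    and f: "continuous_on hyp_plane f" "\<And>y. y \<in> hyp_plane \<Longrightarrow> 0 \<le> f y"
    and h: "0 < h" "h < s" "h \<le> \<rho>" and l: "0 \<le> l"
    and cone: "r - s + h \<le> \<rho>" "s - r \<le> \<rho>" "\<rho> + l \<le> r + s - h"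
    and A: "0 \<le> A" "\<And>y. y \<in> hyp_plane \<Longrightarrow> hyp_dist 0 y \<in> {\<rho>..\<rho> + l} \<Longrightarrow>
      A * exp (- hyp_dist 0 y / 2) \<le> f y"
  shows "shell_const h * A * l * exp (- r / 2) \<le> wave_I s x f"
proof -
  define \<kappa> where "\<kappa> = (1 - exp (- 2 * h)) / 2"
  define C where "C = A * \<kappa> * exp (- (s + r) / 2)"
  have \<kappa>: "0 \<le> \<kappa>" using h by (simp add: \<kappa>_def)
  have C: "0 \<le> C" using A \<kappa> by (simp add: C_def)
  have "C * l / (2 * pi) \<le> circle_mean f x \<sigma>" if \<sigma>: "\<sigma> \<in> {s - h..s}" for \<sigma>
  proof -
    have "C * (\<rho> + l - \<rho>) / (2 * pi) \<le> circle_mean f x \<sigma>"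
    proof (rule circle_mean_lower_bound[OF x r _ _ _ _ _ f C])
      fix y assume y: "y \<in> hyp_plane" "hyp_dist 0 y \<in> {\<rho>..\<rho> + l}"
      define \<eta> where "\<eta> = hyp_dist 0 y"
      \<comment> \<open>As the distance is at least \<open>h\<close>, its \<open>sinh\<close> is comparable to its \<open>exp\<close>, so the loss in
        replacing all factors by exponentials is only a constant.\<close>
      have cosh_le: "cosh a \<le> exp a" if "0 \<le> a" for a :: real
      proof -
        have "exp (- a) \<le> exp a" using that by simp
        then show ?thesis by (simp add: cosh_field_def divide_simps)
      qed
      have "cosh \<sigma> - 1 \<le> exp \<sigma>" "cosh (r + \<eta>) \<le> exp (r + \<eta>)"
        using cosh_le[of \<sigma>] cosh_le[of "r + \<eta>"] \<sigma> h r y by (auto simp: \<eta>_def)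
      then have "(cosh \<sigma> - 1) * cosh (r + \<eta>) \<le> exp \<sigma> * exp (r + \<eta>)"
        using cosh_real_ge_1[of \<sigma>] cosh_real_ge_1[of "r + \<eta>"] by (intro mult_mono) auto
      also have "\<dots> \<le> (exp ((s + r + \<eta>) / 2))\<^sup>2"
        using \<sigma> by (simp add: power2_eq_square flip: exp_add)
      finally have "sqrt ((cosh \<sigma> - 1) * cosh (r + \<eta>)) \<le> exp ((s + r + \<eta>) / 2)"
        by (intro real_le_lsqrt) auto
      then have "C * sqrt ((cosh \<sigma> - 1) * cosh (r + \<eta>)) \<le> C * exp ((s + r + \<eta>) / 2)"
        using C by (rule mult_left_mono)
      also have "\<dots> = A * exp (- \<eta> / 2) * (\<kappa> * exp \<eta>)"
        by (simp add: C_def field_simps flip: exp_add)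
      also have "\<dots> \<le> f y * sinh \<eta>"
      proof (rule mult_mono)
        have "\<kappa> * exp \<eta> \<le> (1 - exp (- 2 * \<eta>)) / 2 * exp \<eta>"
          using y h by (intro mult_right_mono) (auto simp: \<kappa>_def \<eta>_def)
        also have "\<dots> = sinh \<eta>"
          by (simp add: sinh_field_def field_simps flip: exp_add)
        finally show "\<kappa> * exp \<eta> \<le> sinh \<eta>" .
      qed (use A(2)[OF y] f(2) y \<kappa> in \<open>auto simp: \<eta>_def\<close>)
      finally show "C * sqrt ((cosh \<sigma> - 1) * cosh (r + hyp_dist 0 y)) \<le> f y * sinh (hyp_dist 0 y)"
        by (simp add: \<eta>_def)
    qed (use \<sigma> h l cone in auto)
    then show ?thesis by simp
  qed
  from wave_I_lower_bound[OF x f h(1,2) _ this]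
  have low: "(1 - exp (- h)) * exp (s / 2) * (C * l / (2 * pi)) \<le> wave_I s x f"
    using C l by simp
  have eC: "exp (s / 2) * C = A * \<kappa> * exp (- r / 2)"
    by (simp add: C_def field_simps flip: exp_add)
  have "(1 - exp (- h)) * exp (s / 2) * (C * l / (2 * pi))
      = (1 - exp (- h)) * (A * \<kappa> * exp (- r / 2)) * l / (2 * pi)"
    unfolding eC[symmetric] by simp
  also have "\<dots> = shell_const h * A * l * exp (- r / 2)"
    by (simp add: shell_const_def \<kappa>_def)
  finally show ?thesis using low by simp
qed

lemma cosh_minus_one_le:
  assumes "0 \<le> \<sigma>" "\<sigma> \<le> (1::real)" shows "cosh \<sigma> - 1 \<le> \<sigma>\<^sup>2"
proof -
  have "exp (- \<sigma>) \<le> 1 / (1 + \<sigma>)"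
    using assms exp_ge_add_one_self[of \<sigma>] by (simp add: exp_minus field_simps)
  also have "\<dots> \<le> 1 - \<sigma> + \<sigma>\<^sup>2"
    using assms by (simp add: divide_simps) (simp add: algebra_simps power2_eq_square)
  finally show ?thesis
    using exp_bound[OF assms] by (simp add: cosh_field_def divide_simps)
qed

lemma sinh_ge_one:
  assumes "1 \<le> (\<rho>::real)" shows "1 \<le> sinh \<rho>"
proof -
  have e: "exp (1::real) \<ge> 5 / 2" using exp_lower_Taylor_quadratic[of "1::real"] by simp
  then have "exp (- 1::real) \<le> 2 / 5" by (simp add: exp_minus field_simps)
  with e have "1 \<le> sinh (1::real)" by (simp add: sinh_field_def)
  also have "\<dots> \<le> sinh \<rho>" using assms by simp
  finally show ?thesis .
qed

text \<open>For short times the propagator acts like multiplication by \<open>s\<close>: a circle of radius \<open>\<sigma> \<le> 1 / 2\<close>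
  around a point of the annulus spends a fixed fraction of its angle inside the annulus, because
  \<open>r\<close> can move by \<open>\<sigma>\<close> either outwards or inwards without leaving \<open>{1..2}\<close>, while the rate
  of change of the distance to the origin is at most a constant times \<open>\<sigma>\<close>.\<close>

lemma wave_I_annulus:
  fixes r s A :: real
  assumes x: "x \<in> hyp_plane" and r: "hyp_dist 0 x \<in> {1..2}"
    and f: "continuous_on hyp_plane f" "\<And>y. y \<in> hyp_plane \<Longrightarrow> 0 \<le> f y"
    and s: "0 < s" "s \<le> 1 / 2"
    and A: "0 \<le> A" "\<And>y. y \<in> hyp_plane \<Longrightarrow> hyp_dist 0 y \<in> {1..2} \<Longrightarrow> A \<le> f y"
  shows "s * A / (4 * pi * sqrt (cosh 4)) \<le> wave_I s x f"
proof -
  define r where "r = hyp_dist 0 x"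
  have r': "1 \<le> r" "r \<le> 2" using r by (auto simp: r_def)
  define m where "m = A / (2 * pi * sqrt (cosh 4))"
  have m: "0 \<le> m" using A by (simp add: m_def)
  have "m \<le> circle_mean f x \<sigma>" if "\<sigma> \<in> {s - s / 2..s}" for \<sigma>
  proof -
    have \<sigma>: "0 < \<sigma>" "\<sigma> \<le> 1 / 2" using that s by auto
    define \<rho>1 where "\<rho>1 = (if r \<le> 3 / 2 then r else r - \<sigma>)"
    have \<rho>: "1 \<le> \<rho>1" "\<rho>1 + \<sigma> \<le> 2" "\<bar>r - \<sigma>\<bar> \<le> \<rho>1" "\<rho>1 + \<sigma> \<le> r + \<sigma>"
      using r' \<sigma> by (auto simp: \<rho>1_def)
    define C where "C = A / (\<sigma> * sqrt (cosh 4))"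
    have C: "0 \<le> C" using A \<sigma> by (simp add: C_def)
    have "C * (\<rho>1 + \<sigma> - \<rho>1) / (2 * pi) \<le> circle_mean f x \<sigma>"
    proof (rule circle_mean_lower_bound[OF x r_def _ \<sigma>(1) _ _ _ _ f C])
      fix y assume y: "y \<in> hyp_plane" "hyp_dist 0 y \<in> {\<rho>1..\<rho>1 + \<sigma>}"
      have "cosh (r + hyp_dist 0 y) \<le> cosh 4"
        using y \<rho> r' by (subst cosh_real_nonneg_le_iff) auto
      then have "(cosh \<sigma> - 1) * cosh (r + hyp_dist 0 y) \<le> \<sigma>\<^sup>2 * cosh 4"
        using cosh_minus_one_le[of \<sigma>] \<sigma> by (intro mult_mono) auto
      then have "sqrt ((cosh \<sigma> - 1) * cosh (r + hyp_dist 0 y)) \<le> sqrt (\<sigma>\<^sup>2 * cosh 4)"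
        by (rule real_sqrt_le_mono)
      also have "\<dots> = \<sigma> * sqrt (cosh 4)" using \<sigma> by (simp add: real_sqrt_mult)
      finally have "C * sqrt ((cosh \<sigma> - 1) * cosh (r + hyp_dist 0 y)) \<le> C * (\<sigma> * sqrt (cosh 4))"
        using C by (rule mult_left_mono)
      also have "\<dots> = A" using \<sigma> by (simp add: C_def)
      also have "\<dots> = A * 1" by simp
      also have "\<dots> \<le> f y * sinh (hyp_dist 0 y)"
        using y \<rho> f(2)[OF y(1)] A(1) by (intro mult_mono A(2) sinh_ge_one) auto
      finally show "C * sqrt ((cosh \<sigma> - 1) * cosh (r + hyp_dist 0 y)) \<le> f y * sinh (hyp_dist 0 y)" .
    qed (use \<rho> r' \<sigma> in auto)
    also have "C * (\<rho>1 + \<sigma> - \<rho>1) / (2 * pi) = m" using \<sigma> by (simp add: C_def m_def)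
    finally show ?thesis .
  qed
  from wave_I_lower_bound[OF x f _ _ m this] s
  have "(1 - exp (- (s / 2))) * exp (s / 2) * m \<le> wave_I s x f" by simp
  moreover have "s / 2 \<le> (1 - exp (- (s / 2))) * exp (s / 2)"
    using exp_ge_add_one_self[of "s / 2"] by (simp add: algebra_simps flip: exp_add)
  ultimately have "s / 2 * m \<le> wave_I s x f"
    using m by (meson mult_right_mono order_trans)
  then show ?thesis by (simp add: m_def)
qed

lemma exp_decay_le_powr:
  fixes A e :: real
  assumes "0 < A"
  obtains X where "\<And>\<xi>. X \<le> \<xi> \<Longrightarrow> exp (- \<xi> / 2) \<le> A * \<xi> powr e"
proof -
  have "eventually (\<lambda>\<xi>. exp (- \<xi> / 2) \<le> A * \<xi> powr e) at_top"
    using assms by real_asymp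
  then show thesis using that by (auto simp: eventually_at_top_linorder)
qed

text \<open>The exponents that occur may have either sign, hence the absolute value.\<close>

lemma powr_comparable:
  fixes \<xi> \<xi>' e :: real
  assumes "0 < \<xi>" "\<xi> / 8 \<le> \<xi>'" "\<xi>' \<le> \<xi>"
  shows "8 powr (- \<bar>e\<bar>) * \<xi> powr e \<le> \<xi>' powr e"
proof (cases "e \<ge> 0")
  case True
  have "8 powr (- \<bar>e\<bar>) * \<xi> powr e = (\<xi> / 8) powr e"
    using True assms by (simp add: powr_divide powr_minus field_simps)
  also have "\<dots> \<le> \<xi>' powr e" using True assms by (intro powr_mono2) auto
  finally show ?thesis .
next
  case False
  have "8 powr (- \<bar>e\<bar>) \<le> 8 powr (0::real)" by (intro powr_mono) auto
  then have "8 powr (- \<bar>e\<bar>) * \<xi> powr e \<le> 1 * \<xi> powr e" by (intro mult_right_mono) auto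
  also have "\<dots> \<le> \<xi>' powr e" using False assms by (simp add: powr_mono2')
  finally show ?thesis .
qed

section \<open>Consequences of a global solution\<close>

text \<open>These assumptions are contradictory: they include a solution on the whole half line, which the
  lower bounds below refute.\<close>

locale global_solution =
  fixes F :: "real \<Rightarrow> real" and u1 :: "complex \<Rightarrow> real" and U :: "real \<Rightarrow> complex \<Rightarrow> real"
    and p q c \<delta> \<epsilon> \<tau>0 :: real
  assumes p: "1 < p" "p < 3" and q: "1 < q"
    and F_cont: "continuous_on UNIV F" and F0: "F 0 = 0"
    and c: "0 < c" and \<delta>: "0 < \<delta>" "\<delta> < 1"
    and F_small: "\<And>v. 0 < \<bar>v\<bar> \<Longrightarrow> \<bar>v\<bar> \<le> \<delta> \<Longrightarrow> c * ln (1 / \<bar>v\<bar>) powr (1 - p) * \<bar>v\<bar> \<le> F v"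
    and F_large: "\<And>v. \<delta> \<le> \<bar>v\<bar> \<Longrightarrow> c * \<bar>v\<bar> powr q \<le> F v"
    and u1_cont: "continuous_on hyp_plane u1"
    and u1_nonneg: "\<And>y. y \<in> hyp_plane \<Longrightarrow> 0 \<le> u1 y"
    and \<tau>0: "0 < \<tau>0"
    and u1_ge_1: "\<And>y. y \<in> hyp_plane \<Longrightarrow> hyp_dist 0 y \<in> {\<tau>0..3 * \<tau>0} \<Longrightarrow> 1 \<le> u1 y"
    and \<epsilon>: "0 < \<epsilon>"
    and sol: "weak_solution F \<epsilon> u1 {0..} U"
begin

lemma F_nonneg: "0 \<le> F v"
proof (cases "v = 0")
  case False
  then show ?thesis
    using F_small[of v] F_large[of v] c
    by (cases "\<bar>v\<bar> \<le> \<delta>") (auto intro: order_trans[rotated])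
qed (simp add: F0)

text \<open>If \<open>v \<le> \<delta>\<close>, the logarithm is at most \<open>L\<close> and the power \<open>1 - p\<close> is negative. If \<open>v > \<delta>\<close>, the source
  is superlinear and \<open>L powr (1 - p) \<le> 1\<close>. The factor \<open>\<delta> powr (q - 1)\<close> makes one constant serve both
  cases, so the growth argument can treat the source as linear without knowing the size of \<open>U\<close>.\<close>

lemma F_lower_linear:
  assumes L: "1 \<le> L" and b: "exp (- L) \<le> b" and v: "b \<le> v"
  shows "c * \<delta> powr (q - 1) * L powr (1 - p) * b \<le> F v"
proof -
  have b0: "0 < b" using b by (meson exp_gt_zero less_le_trans)
  then have v0: "0 < v" using v by linarith
  define K where "K = c * \<delta> powr (q - 1)"
  have K: "0 \<le> K" using c by (simp add: K_def)
  have "K * L powr (1 - p) * v \<le> F v"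
  proof (cases "v \<le> \<delta>")
    case True
    have "1 / v \<le> 1 / exp (- L)" using b v v0 by (intro divide_left_mono) auto
    then have "ln (1 / v) \<le> L" using v0
      by (metis exp_minus inverse_eq_divide ln_exp ln_le_cancel_iff divide_pos_pos exp_gt_zero
          inverse_inverse_eq zero_less_one)
    moreover have "0 < ln (1 / v)" using True \<delta> v0 by (intro ln_gt_zero) auto
    ultimately have "L powr (1 - p) \<le> ln (1 / v) powr (1 - p)"
      using p by (intro powr_mono2') auto
    moreover have "K \<le> c"
    proof -
      have "\<delta> powr (q - 1) \<le> \<delta> powr 0" using \<delta> q by (intro powr_mono') auto
      then show ?thesis using c \<delta> by (simp add: K_def mult_left_le)
    qed
    ultimately have "K * L powr (1 - p) * v \<le> c * ln (1 / v) powr (1 - p) * v"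
      using K v0 by (intro mult_right_mono mult_mono) auto
    moreover have "c * ln (1 / v) powr (1 - p) * v \<le> F v" using F_small[of v] v0 True by simp
    ultimately show ?thesis by linarith
  next
    case False
    have "L powr (1 - p) \<le> L powr 0" using L p by (intro powr_mono) auto
    then have "K * L powr (1 - p) \<le> K" using K L by (simp add: mult_left_le)
    also have "K \<le> c * v powr (q - 1)"
      unfolding K_def using c False \<delta> q by (intro mult_left_mono powr_mono2) auto
    finally have "K * L powr (1 - p) * v \<le> c * v powr (q - 1) * v"
      using v0 by (intro mult_right_mono) auto
    also have "\<dots> = c * v powr q" using v0 by (simp add: powr_diff)
    also have "\<dots> \<le> F v" using F_large[of v] False v0 by simp
    finally show ?thesis .
  qed
  moreover have "K * L powr (1 - p) * b \<le> K * L powr (1 - p) * v"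
    using v K by (intro mult_left_mono) auto
  ultimately show ?thesis by (simp add: K_def)
qed

lemma U_cont: "continuous_on ({0..} \<times> hyp_plane) (\<lambda>(t, x). U t x)"
  and U_eq: "0 \<le> t \<Longrightarrow> x \<in> hyp_plane \<Longrightarrow>
    U t x = \<epsilon> * wave_I t x u1 + integral {0..t} (\<lambda>\<tau>. wave_I (t - \<tau>) x (\<lambda>y. F (U \<tau> y)))"
  using sol by (auto simp: weak_solution_def)

lemma source_cont: "continuous_on ({0..} \<times> hyp_plane) (\<lambda>(\<tau>, y). F (U \<tau> y))"
  using continuous_on_compose2[OF F_cont U_cont] by (simp add: case_prod_beta)

lemma source_cont_slice:
  assumes "0 \<le> \<tau>" shows "continuous_on hyp_plane (\<lambda>y. F (U \<tau> y))"
proof -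
  have "continuous_on hyp_plane (\<lambda>y. (\<lambda>(\<tau>, y). F (U \<tau> y)) (\<tau>, y))"
    by (rule continuous_on_compose2[OF source_cont]) (use assms in \<open>auto intro!: continuous_intros\<close>)
  then show ?thesis by simp
qed

lemma duhamel_nonneg:
  assumes "0 \<le> t" "x \<in> hyp_plane" "\<tau> \<in> {0..t}"
  shows "0 \<le> wave_I (t - \<tau>) x (\<lambda>y. F (U \<tau> y))"
  using assms by (intro wave_I_nonneg source_cont_slice F_nonneg) auto

lemma duhamel_integrable:
  assumes "x \<in> hyp_plane" "0 \<le> a" "b \<le> t"
  shows "(\<lambda>\<tau>. wave_I (t - \<tau>) x (\<lambda>y. F (U \<tau> y))) integrable_on {a..b}"
proof -
  have "continuous_on ({0..t} \<times> hyp_plane) (\<lambda>(\<tau>, y). F (U \<tau> y))"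
    by (rule continuous_on_subset[OF source_cont]) auto
  then have "continuous_on {0..t} (\<lambda>\<tau>. wave_I (t - \<tau>) x (\<lambda>y. F (U \<tau> y)))"
    by (rule continuous_on_wave_I[OF assms(1)])
  then show ?thesis
    by (intro integrable_continuous_interval) (rule continuous_on_subset, use assms in auto)
qed

lemma linear_lower_bound:
  assumes "0 \<le> t" "x \<in> hyp_plane"
  shows "\<epsilon> * wave_I t x u1 \<le> U t x"
proof -
  have "0 \<le> integral {0..t} (\<lambda>\<tau>. wave_I (t - \<tau>) x (\<lambda>y. F (U \<tau> y)))"
    using duhamel_integrable[of x 0 t t] duhamel_nonneg assms by (intro integral_nonneg) auto
  then show ?thesis using U_eq[OF assms] by simp
qed

lemma duhamel_lower_bound:
  assumes x: "x \<in> hyp_plane" and ab: "0 \<le> a" "a \<le> b" "b \<le> t"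
    and m: "\<And>\<tau>. \<tau> \<in> {a..b} \<Longrightarrow> m \<le> wave_I (t - \<tau>) x (\<lambda>y. F (U \<tau> y))"
  shows "m * (b - a) \<le> U t x"
proof -
  let ?G = "\<lambda>\<tau>. wave_I (t - \<tau>) x (\<lambda>y. F (U \<tau> y))"
  have "m * (b - a) = integral {a..b} (\<lambda>_. m)" using ab by simp
  also have "\<dots> \<le> integral {a..b} ?G"
    by (rule integral_le) (use m duhamel_integrable[OF x] ab in auto)
  also have "\<dots> \<le> integral {0..t} ?G"
    by (rule integral_subset_le) (use duhamel_integrable[OF x] duhamel_nonneg[OF _ x] ab in auto)
  also have "\<dots> \<le> U t x"
    using U_eq[of t x] wave_I_nonneg[OF x u1_cont u1_nonneg, of t] ab x \<epsilon> by simp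
  finally show ?thesis .
qed

text \<open>At most \<open>1\<close> for the sake of the annulus \<open>1 \<le> r \<le> 2\<close>, and at most \<open>\<tau>0 / 2\<close> so that the data still
  reach a strip of full width along the light cone.\<close>

definition margin where "margin = min 1 (\<tau>0 / 2)"

lemma margin: "0 < margin" "margin \<le> 1" "margin \<le> \<tau>0 / 2"
  using \<tau>0 by (auto simp: margin_def)

lemma shell_const_margin_pos: "0 < shell_const margin"
  using margin by (simp add: shell_const_def)

definition gain where "gain = shell_const margin * (c * \<delta> powr (q - 1))"

lemma gain_pos: "0 < gain"
  using shell_const_margin_pos c \<delta> by (simp add: gain_def)

text \<open>The outer half \<open>{2 * \<tau>0..3 * \<tau>0}\<close> of the annulus carrying the data lies, with a margin, in the
  domain of dependence of every point of the strip.\<close>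

lemma strip_lower_bound:
  assumes x: "x \<in> hyp_plane" and r: "r = hyp_dist 0 x"
    and cone: "0 \<le> t - r" "t - r \<le> 2 * \<tau>0" "4 * \<tau>0 \<le> t + r"
  shows "\<epsilon> * shell_const margin * \<tau>0 * exp (- r / 2) \<le> U t x"
proof -
  have "shell_const margin * 1 * \<tau>0 * exp (- r / 2) \<le> wave_I t x u1"
  proof (rule wave_I_shell[OF x r _ u1_cont u1_nonneg margin(1), where \<rho> = "2 * \<tau>0"])
    fix y assume y: "y \<in> hyp_plane" "hyp_dist 0 y \<in> {2 * \<tau>0..2 * \<tau>0 + \<tau>0}"
    have "1 * exp (- hyp_dist 0 y / 2) \<le> 1" using y \<tau>0 by simp
    also have "\<dots> \<le> u1 y" using y \<tau>0 by (intro u1_ge_1) auto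
    finally show "1 * exp (- hyp_dist 0 y / 2) \<le> u1 y" .
  qed (use cone margin \<tau>0 in auto)
  then have "\<epsilon> * (shell_const margin * 1 * \<tau>0 * exp (- r / 2)) \<le> \<epsilon> * wave_I t x u1"
    using \<epsilon> by (intro mult_left_mono) auto
  also have "\<dots> \<le> U t x" using cone \<tau>0 by (intro linear_lower_bound x) auto
  finally show ?thesis by (simp add: mult.assoc)
qed

text \<open>One application of the Duhamel formula. The inner radius \<open>\<rho> \<tau>\<close> of the shell may move with \<open>\<tau>\<close>, which is
  needed for the strip along the light cone. The weights \<open>exp (- r / 2)\<close> cancel, so that a lower
  bound \<open>A\<close> for \<open>v = exp (r / 2) * U\<close> on a region of size \<open>l\<close> by \<open>b - a\<close> is multiplied by the
  area of the region and by the size \<open>L powr (1 - p)\<close> of the effective potential. The bounds on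
  \<open>L\<close> guarantee \<open>U \<ge> exp (- L)\<close> on the region.\<close>

lemma source_gain:
  fixes \<rho> :: "real \<Rightarrow> real"
  assumes x: "x \<in> hyp_plane" and r: "r = hyp_dist 0 x" "0 < r"
    and ab: "0 \<le> a" "a \<le> b" "b + margin < t" and l: "0 \<le> l"
    and L: "1 \<le> L" "exp (- L / 2) \<le> A"
    and cone: "\<And>\<tau>. \<tau> \<in> {a..b} \<Longrightarrow> margin \<le> \<rho> \<tau> \<and> r - (t - \<tau>) + margin \<le> \<rho> \<tau> \<and> t - \<tau> - r \<le> \<rho> \<tau>
        \<and> \<rho> \<tau> + l \<le> r + (t - \<tau>) - margin \<and> \<rho> \<tau> + l \<le> L"
    and low: "\<And>\<tau> y. \<tau> \<in> {a..b} \<Longrightarrow> y \<in> hyp_plane \<Longrightarrow> hyp_dist 0 y \<in> {\<rho> \<tau>..\<rho> \<tau> + l} \<Longrightarrow>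
      A * exp (- hyp_dist 0 y / 2) \<le> U \<tau> y"
  shows "gain * L powr (1 - p) * A * l * (b - a) * exp (- r / 2) \<le> U t x"
proof -
  define B where "B = c * \<delta> powr (q - 1) * L powr (1 - p) * A"
  have A: "0 < A" using L by (meson exp_gt_zero less_le_trans)
  have B: "0 \<le> B" using A c by (simp add: B_def)
  have "shell_const margin * B * l * exp (- r / 2) \<le> wave_I (t - \<tau>) x (\<lambda>y. F (U \<tau> y))" if \<tau>: "\<tau> \<in> {a..b}" for \<tau>
  proof (rule wave_I_shell[OF x r source_cont_slice F_nonneg margin(1)])
    fix y assume y: "y \<in> hyp_plane" "hyp_dist 0 y \<in> {\<rho> \<tau>..\<rho> \<tau> + l}"
    have "exp (- L) \<le> exp (- L / 2) * exp (- hyp_dist 0 y / 2)"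
      using y cone[OF \<tau>] by (simp flip: exp_add)
    also have "\<dots> \<le> A * exp (- hyp_dist 0 y / 2)"
      using L by (intro mult_right_mono) auto
    finally have "c * \<delta> powr (q - 1) * L powr (1 - p) * (A * exp (- hyp_dist 0 y / 2)) \<le> F (U \<tau> y)"
      by (rule F_lower_linear[OF L(1) _ low[OF \<tau> y]])
    then show "B * exp (- hyp_dist 0 y / 2) \<le> F (U \<tau> y)" by (simp add: B_def mult.assoc)
  qed (use \<tau> ab cone[OF \<tau>] l B in auto)
  from duhamel_lower_bound[OF x ab(1,2) _ this] ab margin
  have "shell_const margin * B * l * exp (- r / 2) * (b - a) \<le> U t x" by simp
  then show ?thesis by (simp add: B_def gain_def mult_ac)
qed

text \<open>Growth of \<open>v = exp (r / 2) * U\<close> like a power of \<open>\<xi> = t - r\<close>, in the part \<open>\<xi> \<le> 2 * r\<close> of the light cone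
  that stays away from the axis. For a point of this part, a
  rectangle of size comparable to \<open>\<xi>\<close> in its domain of dependence lies in the same part, which is why
  the growth can be iterated.\<close>

definition interior_growth :: "real \<Rightarrow> bool" where
  "interior_growth e \<longleftrightarrow> (\<exists>C>0. \<exists>X. \<forall>t. \<forall>x\<in>hyp_plane.
     X \<le> t - hyp_dist 0 x \<longrightarrow> t - hyp_dist 0 x \<le> 2 * hyp_dist 0 x \<longrightarrow>
     C * (t - hyp_dist 0 x) powr e * exp (- hyp_dist 0 x / 2) \<le> U t x)"

lemma interior_growthI:
  assumes "0 < C" "\<And>t x r. x \<in> hyp_plane \<Longrightarrow> r = hyp_dist 0 x \<Longrightarrow> X \<le> t - r \<Longrightarrow> t - r \<le> 2 * r \<Longrightarrow>
     C * (t - r) powr e * exp (- r / 2) \<le> U t x"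
  shows "interior_growth e"
  unfolding interior_growth_def using assms by blast

lemma interior_growthE:
  assumes "interior_growth e"
  obtains C X where "0 < C" "\<And>t x. x \<in> hyp_plane \<Longrightarrow> X \<le> t - hyp_dist 0 x \<Longrightarrow>
     t - hyp_dist 0 x \<le> 2 * hyp_dist 0 x \<Longrightarrow>
     C * (t - hyp_dist 0 x) powr e * exp (- hyp_dist 0 x / 2) \<le> U t x"
  using assms unfolding interior_growth_def by blast

text \<open>The strip has fixed width, so integrating over it gains only one factor \<open>\<xi>\<close> besides
  the potential \<open>\<xi> powr (1 - p)\<close>. For \<open>p > 2\<close> the resulting exponent is negative, and the growth comes from
  the iteration alone.\<close>

lemma interior_growth_base: "interior_growth (2 - p)"
proof -
  define A where "A = \<epsilon> * shell_const margin * \<tau>0"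
  have A: "0 < A" using \<epsilon> shell_const_margin_pos \<tau>0 by (simp add: A_def)
  obtain X0 where X0: "\<And>\<xi>. X0 \<le> \<xi> \<Longrightarrow> exp (- \<xi> / 2) \<le> A * \<xi> powr 0"
    using exp_decay_le_powr[OF A] by blast
  define X where "X = Max {X0, 8 * \<tau>0, 1}"
  show ?thesis
  proof (rule interior_growthI[where C = "gain * A * \<tau>0 / 2" and X = X])
    show "0 < gain * A * \<tau>0 / 2" using gain_pos A \<tau>0 by simp
    fix t x r assume x: "x \<in> hyp_plane" "r = hyp_dist 0 x" and \<xi>: "X \<le> t - r" "t - r \<le> 2 * r"
    define \<xi> where "\<xi> = t - r"
    have t: "t = \<xi> + r" by (simp add: \<xi>_def)
    have \<xi>': "X0 \<le> \<xi>" "8 * \<tau>0 \<le> \<xi>" "1 \<le> \<xi>" "\<xi> \<le> 2 * r"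
      using \<xi> by (auto simp: X_def \<xi>_def)
    have "gain * \<xi> powr (1 - p) * A * (2 * \<tau>0) * (7 * \<xi> / 8 - 5 * \<xi> / 8) * exp (- r / 2) \<le> U t x"
    proof (rule source_gain[OF x, where \<rho> = "\<lambda>\<tau>. \<tau> - 2 * \<tau>0"])
      fix \<tau> y assume "\<tau> \<in> {5 * \<xi> / 8..7 * \<xi> / 8}" and y: "y \<in> hyp_plane"
        "hyp_dist 0 y \<in> {\<tau> - 2 * \<tau>0..\<tau> - 2 * \<tau>0 + 2 * \<tau>0}"
      then show "A * exp (- hyp_dist 0 y / 2) \<le> U \<tau> y"
        unfolding A_def using \<xi>' \<tau>0 by (intro strip_lower_bound) auto
    qed (use \<xi>' margin \<tau>0 X0[of \<xi>] in \<open>auto simp: t\<close>)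
    moreover have "\<xi> powr (2 - p) = \<xi> powr (1 - p) * \<xi>"
      using \<xi>' by (simp add: powr_add[of \<xi> "1 - p" 1, simplified])
    ultimately show "gain * A * \<tau>0 / 2 * (t - r) powr (2 - p) * exp (- r / 2) \<le> U t x"
      unfolding \<xi>_def[symmetric] by (simp add: mult_ac)
  qed
qed

text \<open>The rectangle \<open>\<tau> \<in> {7 * \<xi> / 8..\<xi>}\<close>, \<open>\<rho> \<in> {\<xi> / 2..5 * \<xi> / 8}\<close> lies in the domain of dependence of
  the point, satisfies \<open>\<xi> / 4 \<le> \<tau> - \<rho> \<le> \<xi> / 2 \<le> 2 * \<rho>\<close>, and has area of order \<open>\<xi>\<^sup>2\<close>. Together
  with the potential this is a gain of \<open>\<xi> powr (3 - p)\<close>.\<close>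

lemma interior_growth_step:
  assumes "interior_growth e"
  shows "interior_growth (e + (3 - p))"
proof -
  obtain C X1 where C: "0 < C" and low: "\<And>t x. x \<in> hyp_plane \<Longrightarrow> X1 \<le> t - hyp_dist 0 x \<Longrightarrow>
     t - hyp_dist 0 x \<le> 2 * hyp_dist 0 x \<Longrightarrow>
     C * (t - hyp_dist 0 x) powr e * exp (- hyp_dist 0 x / 2) \<le> U t x"
    using interior_growthE[OF assms] by blast
  define m where "m = C * 8 powr (- \<bar>e\<bar>)"
  have m: "0 < m" using C by (simp add: m_def)
  obtain X0 where X0: "\<And>\<xi>. X0 \<le> \<xi> \<Longrightarrow> exp (- \<xi> / 2) \<le> m * \<xi> powr e"
    using exp_decay_le_powr[OF m] by blast
  define X where "X = Max {X0, 4 * X1, 8}"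
  show ?thesis
  proof (rule interior_growthI[where C = "gain * m / 64" and X = X])
    show "0 < gain * m / 64" using gain_pos m by simp
    fix t x r assume x: "x \<in> hyp_plane" "r = hyp_dist 0 x" and \<xi>: "X \<le> t - r" "t - r \<le> 2 * r"
    define \<xi> where "\<xi> = t - r"
    have t: "t = \<xi> + r" by (simp add: \<xi>_def)
    have \<xi>': "X0 \<le> \<xi>" "4 * X1 \<le> \<xi>" "8 \<le> \<xi>" "\<xi> \<le> 2 * r"
      using \<xi> by (auto simp: X_def \<xi>_def)
    have "gain * \<xi> powr (1 - p) * (m * \<xi> powr e) * (\<xi> / 8) * (\<xi> - 7 * \<xi> / 8) * exp (- r / 2) \<le> U t x"
    proof (rule source_gain[OF x, where \<rho> = "\<lambda>\<tau>. \<xi> / 2"])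
      fix \<tau> y assume y: "\<tau> \<in> {7 * \<xi> / 8..\<xi>}" "y \<in> hyp_plane" "hyp_dist 0 y \<in> {\<xi> / 2..\<xi> / 2 + \<xi> / 8}"
      let ?\<rho> = "hyp_dist 0 y"
      have "8 powr (- \<bar>e\<bar>) * \<xi> powr e \<le> (\<tau> - ?\<rho>) powr e"
        using y \<xi>' by (intro powr_comparable) auto
      then have "m * \<xi> powr e * exp (- ?\<rho> / 2) \<le> C * (\<tau> - ?\<rho>) powr e * exp (- ?\<rho> / 2)"
        using C by (simp add: m_def mult.assoc)
      also have "\<dots> \<le> U \<tau> y" using y \<xi>' by (intro low) auto
      finally show "m * \<xi> powr e * exp (- ?\<rho> / 2) \<le> U \<tau> y" .
    qed (use \<xi>' margin X0[of \<xi>] in \<open>auto simp: t\<close>)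
    moreover have "\<xi> powr (e + (3 - p)) = \<xi> powr (1 - p) * \<xi> powr e * \<xi> * \<xi>"
      using \<xi>' powr_add[of \<xi> "1 - p" e] powr_add[of \<xi> "1 - p + e" 2] by (simp add: power2_eq_square algebra_simps)
    ultimately show "gain * m / 64 * (t - r) powr (e + (3 - p)) * exp (- r / 2) \<le> U t x"
      unfolding \<xi>_def[symmetric] by (simp add: mult_ac)
  qed
qed

lemma interior_growth_iterate: "interior_growth (2 - p + real n * (3 - p))"
proof (induction n)
  case 0 then show ?case using interior_growth_base by simp
next
  case (Suc n)
  from interior_growth_step[OF this] show ?case by (simp add: algebra_simps)
qed

text \<open>For a point of the annulus the domain of dependence meets the region of interior growth in a band of bounded
  width along an incoming characteristic, \<open>\<rho> \<in> {\<xi> - \<tau>..\<xi> - \<tau> + 1}\<close>. The band gains only one factor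
  \<open>\<xi>\<close>, which is harmless because the exponent of the interior growth is as large as one likes.\<close>

lemma central_growth: "\<exists>T\<ge>0. \<forall>t\<ge>T. \<forall>x\<in>hyp_plane. hyp_dist 0 x \<in> {1..2} \<longrightarrow> B \<le> U t x"
proof -
  obtain n :: nat where n: "2 * (p - 2) < real n * (3 - p)"
    using reals_Archimedean3[of "3 - p"] p by auto
  define e where "e = 2 - p + real n * (3 - p)"
  have e: "0 < e + 2 - p" using n by (simp add: e_def)
  obtain C X1 where C: "0 < C" and low: "\<And>t x. x \<in> hyp_plane \<Longrightarrow> X1 \<le> t - hyp_dist 0 x \<Longrightarrow>
     t - hyp_dist 0 x \<le> 2 * hyp_dist 0 x \<Longrightarrow>
     C * (t - hyp_dist 0 x) powr e * exp (- hyp_dist 0 x / 2) \<le> U t x"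
    using interior_growthE[OF interior_growth_iterate[of n]] unfolding e_def by blast
  define m where "m = C * 8 powr (- \<bar>e\<bar>)"
  have m: "0 < m" using C by (simp add: m_def)
  obtain X0 where X0: "\<And>\<xi>. X0 \<le> \<xi> \<Longrightarrow> exp (- \<xi> / 2) \<le> m * \<xi> powr e"
    using exp_decay_le_powr[OF m] by blast
  define D where "D = gain * m / 8 * exp (- 1)"
  have D: "0 < D" using gain_pos m by (simp add: D_def)
  have "filterlim (\<lambda>\<xi>. D * \<xi> powr (e + 2 - p)) at_top at_top"
    using D e by real_asymp
  then obtain X2 where X2: "\<And>\<xi>. X2 \<le> \<xi> \<Longrightarrow> B \<le> D * \<xi> powr (e + 2 - p)"
    by (auto simp: filterlim_at_top eventually_at_top_linorder)
  define X where "X = Max {X0, 8 * X1, X2, 8}"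
  have "B \<le> U t x" if t: "X + 2 \<le> t" and x: "x \<in> hyp_plane" "hyp_dist 0 x \<in> {1..2}" for t x
  proof -
    define r where "r = hyp_dist 0 x"
    define \<xi> where "\<xi> = t - r"
    have t': "t = \<xi> + r" by (simp add: \<xi>_def)
    have r: "1 \<le> r" "r \<le> 2" using x by (auto simp: r_def)
    have "X \<le> \<xi>" using t r by (simp add: \<xi>_def)
    then have \<xi>: "X0 \<le> \<xi>" "8 * X1 \<le> \<xi>" "X2 \<le> \<xi>" "8 \<le> \<xi>" by (auto simp: X_def)
    have "gain * \<xi> powr (1 - p) * (m * \<xi> powr e) * 1 * (6 * \<xi> / 8 - 5 * \<xi> / 8) * exp (- r / 2) \<le> U t x"
    proof (rule source_gain[OF x(1) r_def, where \<rho> = "\<lambda>\<tau>. \<xi> - \<tau>"])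
      fix \<tau> y assume y: "\<tau> \<in> {5 * \<xi> / 8..6 * \<xi> / 8}" "y \<in> hyp_plane" "hyp_dist 0 y \<in> {\<xi> - \<tau>..\<xi> - \<tau> + 1}"
      let ?\<rho> = "hyp_dist 0 y"
      have "8 powr (- \<bar>e\<bar>) * \<xi> powr e \<le> (\<tau> - ?\<rho>) powr e"
        using y \<xi> by (intro powr_comparable) auto
      then have "m * \<xi> powr e * exp (- ?\<rho> / 2) \<le> C * (\<tau> - ?\<rho>) powr e * exp (- ?\<rho> / 2)"
        using C by (simp add: m_def mult.assoc)
      also have "\<dots> \<le> U \<tau> y" using y \<xi> by (intro low) auto
      finally show "m * \<xi> powr e * exp (- ?\<rho> / 2) \<le> U \<tau> y" .
    qed (use \<xi> margin r X0[of \<xi>] in \<open>auto simp: t'\<close>)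
    moreover have "\<xi> powr (e + 2 - p) = \<xi> powr (1 - p) * \<xi> powr e * \<xi>"
      using \<xi> powr_add[of \<xi> "1 - p" e] powr_add[of \<xi> "1 - p + e" 1] by (simp add: algebra_simps)
    ultimately have "gain * m / 8 * \<xi> powr (e + 2 - p) * exp (- r / 2) \<le> U t x"
      by (simp add: mult_ac)
    moreover have "D * \<xi> powr (e + 2 - p) \<le> gain * m / 8 * \<xi> powr (e + 2 - p) * exp (- r / 2)"
    proof -
      have "exp (- 1) \<le> exp (- r / 2)" using r by simp
      then have "gain * m / 8 * \<xi> powr (e + 2 - p) * exp (- 1) \<le> gain * m / 8 * \<xi> powr (e + 2 - p) * exp (- r / 2)"
        using gain_pos m by (intro mult_left_mono) auto
      then show ?thesis by (simp add: D_def mult_ac)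
    qed
    ultimately show ?thesis using X2[OF \<xi>(3)] by linarith
  qed
  moreover have "0 \<le> X + 2" by (simp add: X_def)
  ultimately show ?thesis by blast
qed

text \<open>The source on the annulus during the last \<open>a\<close> units of time already contributes a multiple of
  \<open>a\<^sup>2 * B powr q\<close>, as for the ordinary differential equation \<open>u_tt = c * u powr q\<close>.\<close>

lemma local_amplification:
  assumes B: "\<delta> \<le> B" "\<And>t x. T \<le> t \<Longrightarrow> x \<in> hyp_plane \<Longrightarrow> hyp_dist 0 x \<in> {1..2} \<Longrightarrow> B \<le> U t x"
    and a: "0 < a" "a \<le> 1 / 2" and T: "0 \<le> T"
    and t: "T + a \<le> t" and x: "x \<in> hyp_plane" "hyp_dist 0 x \<in> {1..2}"
  shows "c / (16 * pi * sqrt (cosh 4)) * a\<^sup>2 * B powr q \<le> U t x"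
proof -
  have "a / 2 * (c * B powr q) / (4 * pi * sqrt (cosh 4)) \<le> wave_I (t - \<tau>) x (\<lambda>y. F (U \<tau> y))"
    if \<tau>: "\<tau> \<in> {t - a..t - a / 2}" for \<tau>
  proof -
    have "(t - \<tau>) * (c * B powr q) / (4 * pi * sqrt (cosh 4)) \<le> wave_I (t - \<tau>) x (\<lambda>y. F (U \<tau> y))"
    proof (rule wave_I_annulus[OF x source_cont_slice F_nonneg])
      fix y assume y: "y \<in> hyp_plane" "hyp_dist 0 y \<in> {1..2}"
      have BU: "B \<le> U \<tau> y" using \<tau> t y by (intro B(2)) auto
      then have "c * B powr q \<le> c * \<bar>U \<tau> y\<bar> powr q"
        using c q B(1) \<delta> by (intro mult_left_mono powr_mono2) auto
      also have "\<dots> \<le> F (U \<tau> y)" using BU B(1) by (intro F_large) auto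
      finally show "c * B powr q \<le> F (U \<tau> y)" .
    qed (use \<tau> a t T c in auto)
    moreover have "a / 2 * (c * B powr q) / (4 * pi * sqrt (cosh 4)) \<le> (t - \<tau>) * (c * B powr q) / (4 * pi * sqrt (cosh 4))"
      using \<tau> c by (intro divide_right_mono mult_right_mono) auto
    ultimately show ?thesis by linarith
  qed
  \<comment> \<open>Stopping at \<open>t - a / 2\<close> keeps the factor \<open>t - \<tau>\<close> of the short-time bound at least \<open>a / 2\<close>.\<close>
  from duhamel_lower_bound[where a = "t - a" and b = "t - a / 2", OF x(1) _ _ _ this] t T a
  have "a / 2 * (c * B powr q) / (4 * pi * sqrt (cosh 4)) * (t - a / 2 - (t - a)) \<le> U t x" by simp
  moreover have "t - a / 2 - (t - a) = a / 2" by simp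
  ultimately show ?thesis by (simp add: power2_eq_square mult_ac)
qed

text \<open>The waiting times \<open>(1 / 2) ^ Suc n\<close> add up to one, and each of them costs a factor \<open>4\<close>
  more than its predecessor. A geometric sequence of bounds with ratio \<open>\<beta>\<close> survives this if
  \<open>\<beta> powr (q - 1) = 4\<close> and the first bound \<open>B\<close> is large enough; \<open>central_growth\<close> supplies such a start.\<close>

lemma no_global_solution: False
proof -
  define k where "k = c / (16 * pi * sqrt (cosh 4))"
  have k: "0 < k" using c by (simp add: k_def)
  define \<beta> :: real where "\<beta> = 4 powr (1 / (q - 1))"
  have \<beta>: "1 < \<beta>" "\<beta> powr (q - 1) = 4"
    using q by (auto simp: \<beta>_def powr_powr)
  define B where "B = max \<delta> ((4 * \<beta> / k) powr (1 / (q - 1)))"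
  have B: "\<delta> \<le> B" "0 < B" using \<delta> by (auto simp: B_def)
  have "((4 * \<beta> / k) powr (1 / (q - 1))) powr (q - 1) \<le> B powr (q - 1)"
    using q by (intro powr_mono2) (auto simp: B_def)
  then have Bk: "4 * \<beta> / k \<le> B powr (q - 1)"
    using q \<beta> k by (simp add: powr_powr)
  obtain T where T: "0 \<le> T" "\<And>t x. T \<le> t \<Longrightarrow> x \<in> hyp_plane \<Longrightarrow> hyp_dist 0 x \<in> {1..2} \<Longrightarrow> B \<le> U t x"
    using central_growth[of B] by blast
  have main: "B * \<beta> ^ n \<le> U t x"
    if "T + 1 - (1 / 2) ^ n \<le> t" "x \<in> hyp_plane" "hyp_dist 0 x \<in> {1..2}" for n t x
    using that
  proof (induction n arbitrary: t x)
    case 0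
    then show ?case using T(2) by simp
  next
    case (Suc n)
    have pos: "0 < B * \<beta> ^ n" using B \<beta> by simp
    have half: "(1 / 2 :: real) ^ n \<le> 1" by (simp add: power_le_one)
    have "B * 1 \<le> B * \<beta> ^ n" using B \<beta> by (intro mult_left_mono one_le_power) auto
    then have "\<delta> \<le> B * \<beta> ^ n" using B by linarith
    then have "k * ((1 / 2) ^ Suc n)\<^sup>2 * (B * \<beta> ^ n) powr q \<le> U t x"
      unfolding k_def using Suc.prems T(1) half B
      by (intro local_amplification[where T = "T + 1 - (1 / 2) ^ n"] Suc.IH) (auto simp del: power_Suc simp: power_Suc[of _ n])
    moreover have "(B * \<beta> ^ n) powr q = B * \<beta> ^ n * (B powr (q - 1) * 4 ^ n)"
    proof -
      have "(B * \<beta> ^ n) powr q = (B * \<beta> ^ n) powr 1 * (B * \<beta> ^ n) powr (q - 1)"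
        using powr_add[of "B * \<beta> ^ n" 1 "q - 1"] by simp
      moreover have "(\<beta> ^ n) powr (q - 1) = 4 ^ n"
        using \<beta> by (metis less_trans mult.commute powr_powr powr_realpow zero_less_one zero_less_numeral)
      ultimately show ?thesis using pos B \<beta> by (simp add: powr_mult)
    qed
    moreover have "((1 / 2 :: real) ^ Suc n)\<^sup>2 * 4 ^ n = 1 / 4"
      by (simp add: power2_eq_square power_divide flip: power_mult_distrib)
    ultimately have "k * (B powr (q - 1) * (B * \<beta> ^ n)) * (((1 / 2 :: real) ^ Suc n)\<^sup>2 * 4 ^ n) \<le> U t x"
      by (simp only: mult_ac)
    then have "k / 4 * B powr (q - 1) * (B * \<beta> ^ n) \<le> U t x"
      unfolding \<open>((1 / 2 :: real) ^ Suc n)\<^sup>2 * 4 ^ n = 1 / 4\<close> by simp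
    moreover have "\<beta> \<le> k / 4 * B powr (q - 1)" using Bk k by (simp add: field_simps)
    then have "\<beta> * (B * \<beta> ^ n) \<le> k / 4 * B powr (q - 1) * (B * \<beta> ^ n)"
      using pos by (intro mult_right_mono) auto
    ultimately show ?case by (simp add: mult_ac)
  qed
  define x where "x = hyp_polar 0 1 0"
  have x: "x \<in> hyp_plane" "hyp_dist 0 x = 1"
    using hyp_polar_in_hyp_plane[of 0 1 0] hyp_dist_hyp_polar[of 0 1 0] by (auto simp: x_def hyp_plane_def)
  obtain n where "U (T + 1) x / B < \<beta> ^ n" using real_arch_pow[OF \<beta>(1)] by blast
  then have "U (T + 1) x < B * \<beta> ^ n" using B by (simp add: field_simps)
  then show False using main[of n "T + 1" x] x by simp
qed

end

theorem theorem1p2: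
  fixes F \<phi> :: "real \<Rightarrow> real" and u1 :: "complex \<Rightarrow> real"
    and p q c \<delta> \<epsilon> \<tau>0 :: real
    and J :: "real set" and u :: "real \<Rightarrow> complex \<Rightarrow> real"
  assumes "1 < p" "p < 3" "1 < q"
    and "F C1_differentiable_on UNIV" "F 0 = 0" "deriv F 0 = 0"
    and "c > 0" "0 < \<delta>" "\<delta> < 1"
    and "\<And>v. 0 < \<bar>v\<bar> \<Longrightarrow> \<bar>v\<bar> \<le> \<delta> \<Longrightarrow> F v \<ge> c * ln (1 / \<bar>v\<bar>) powr (1 - p) * \<bar>v\<bar>"
    and "\<And>v. \<bar>v\<bar> \<ge> \<delta> \<Longrightarrow> F v \<ge> c * \<bar>v\<bar> powr q"
    and "continuous_on hyp_plane u1"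
    and "\<exists>K. compact K \<and> K \<subseteq> hyp_plane \<and> (\<forall>x\<in>hyp_plane - K. u1 x = 0)"
    and "\<And>x. x \<in> hyp_plane \<Longrightarrow> u1 x \<ge> 0"
    and "\<And>x. x \<in> hyp_plane \<Longrightarrow> u1 x = \<phi> (hyp_dist 0 x)"
    and "\<tau>0 > 0" "\<And>\<tau>. \<tau> \<in> {\<tau>0..3 * \<tau>0} \<Longrightarrow> \<phi> \<tau> \<ge> 1"
    and "\<epsilon> > 0"
    and "weak_solution F \<epsilon> u1 J u"
  shows "\<not> (\<exists>U. weak_solution F \<epsilon> u1 {0..} U \<and> (\<forall>t\<in>J. \<forall>x\<in>hyp_plane. U t x = u t x))"
proof
  assume "\<exists>U. weak_solution F \<epsilon> u1 {0..} U \<and> (\<forall>t\<in>J. \<forall>x\<in>hyp_plane. U t x = u t x)"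
  then obtain U where U: "weak_solution F \<epsilon> u1 {0..} U" by blast
  have "continuous_on UNIV F"
    using assms(4) by (rule C1_differentiable_imp_continuous_on)
  then interpret global_solution F u1 U p q c \<delta> \<epsilon> \<tau>0
    using assms U by unfold_locales auto
  show False by (rule no_global_solution)
qed

end
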